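(* Let $\mathbb{F}\in\{\mathbb{R},\mathbb{C},\mathbb{H}\}$, let $n>m$, and let $\overset{\circ}{\mathcal{M}}(n,m,\mathbb{F})$ be the manifold of $n\times m$ matrices over $\mathbb{F}$ whose $m$ singular values are nonzero and pairwise distinct, with the Frobenius metric. Let $K=U(n)\times U(m)$ act by $(U,V):M\mapsto UMV^*$. Then the quotient map $\phi:\overset{\circ}{\mathcal{M}}(n,m,\mathbb{F})\to\overset{\circ}{\mathcal{M}}(n,m,\mathbb{F})/K$ is a Riemannian submersion. The quotient is parametrised by a single chart, consisting of the Weyl chamber $\{(\sigma_1,\dots,\sigma_m)\in\mathbb{R}^m:\sigma_1>\cdots>\sigma_m>0\}$ of singular values, equipped with the Euclidean metric.
   Context: $\mathbb{H}$ denotes the quaternions. $A^*$ is the (conjugate) transpose over $\mathbb{F}$, and $U(k)=U(k,\mathbb{F})$ is the group of $k\times k$ matrices over $\mathbb{F}$ with $UU^*=I$. The Frobenius metric is $\langle A,B\rangle=\operatorname{Re}\operatorname{Tr}(AB^* )$. The chart sends $(\sigma_1,\dots,\sigma_m)$ to the $K$-orbit of the $n\times m$ matrix whose top $m\times m$ block is $\operatorname{diag}(\sigma_1,\dots,\sigma_m)$ and whose remaining rows are zero. The quotient carries the natural quotient metric. *)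

theory Defs
  imports "HOL-Analysis.Analysis"
begin

section \<open>The scalars: real numbers, complex numbers, quaternions\<close>

codatatype quat = Quat (q1: real) (qi: real) (qj: real) (qk: real)

lemma quat_eq_iff: "x = y \<longleftrightarrow> q1 x = q1 y \<and> qi x = qi y \<and> qj x = qj y \<and> qk x = qk y"
  by (auto intro: quat.expand)

instantiation quat :: ab_group_add
begin

primcorec zero_quat where
  "q1 0 = 0" | "qi 0 = 0" | "qj 0 = 0" | "qk 0 = 0"

primcorec plus_quat where
  "q1 (x + y) = q1 x + q1 y"
| "qi (x + y) = qi x + qi y"
| "qj (x + y) = qj x + qj y"
| "qk (x + y) = qk x + qk y"

primcorec uminus_quat where
  "q1 (- x) = - q1 x" | "qi (- x) = - qi x" | "qj (- x) = - qj x" | "qk (- x) = - qk x"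

primcorec minus_quat where
  "q1 (x - y) = q1 x - q1 y"
| "qi (x - y) = qi x - qi y"
| "qj (x - y) = qj x - qj y"
| "qk (x - y) = qk x - qk y"

instance
  by standard (simp_all add: quat_eq_iff)

end

instantiation quat :: real_algebra_1
begin

primcorec one_quat where
  "q1 1 = 1" | "qi 1 = 0" | "qj 1 = 0" | "qk 1 = 0"

primcorec times_quat where
  "q1 (x * y) = q1 x * q1 y - qi x * qi y - qj x * qj y - qk x * qk y"
| "qi (x * y) = q1 x * qi y + qi x * q1 y + qj x * qk y - qk x * qj y"
| "qj (x * y) = q1 x * qj y - qi x * qk y + qj x * q1 y + qk x * qi y"
| "qk (x * y) = q1 x * qk y + qi x * qj y - qj x * qi y + qk x * q1 y"

primcorec scaleR_quat where
  "q1 (scaleR r x) = r * q1 x"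
| "qi (scaleR r x) = r * qi x"
| "qj (scaleR r x) = r * qj x"
| "qk (scaleR r x) = r * qk x"

instance
  by standard (simp_all add: quat_eq_iff algebra_simps)

end

instantiation quat :: real_inner
begin

definition inner_quat :: "quat \<Rightarrow> quat \<Rightarrow> real" where
  "inner_quat x y = q1 x * q1 y + qi x * qi y + qj x * qj y + qk x * qk y"

definition norm_quat :: "quat \<Rightarrow> real" where
  "norm_quat x = sqrt (inner x x)"

definition sgn_quat :: "quat \<Rightarrow> quat" where
  "sgn_quat x = x /\<^sub>R norm x"

definition dist_quat :: "quat \<Rightarrow> quat \<Rightarrow> real" where
  "dist_quat x y = norm (x - y)"

definition uniformity_quat :: "(quat \<times> quat) filter" where
  "uniformity_quat = (INF e\<in>{0 <..}. principal {(x, y). dist x y < e})"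

definition open_quat :: "quat set \<Rightarrow> bool" where
  "open_quat U \<longleftrightarrow> (\<forall>x\<in>U. eventually (\<lambda>(x', y). x' = x \<longrightarrow> y \<in> U) uniformity)"

instance
proof
  fix x y z :: quat and r :: real
  show "inner x x = 0 \<longleftrightarrow> x = 0"
    unfolding inner_quat_def
    by (auto simp: quat_eq_iff add_nonneg_eq_0_iff)
  show "inner x y = inner y x" "inner (x + y) z = inner x z + inner y z"
    "inner (r *\<^sub>R x) y = r * inner x y" "0 \<le> inner x x"
    by (simp_all add: inner_quat_def algebra_simps)
qed (rule norm_quat_def sgn_quat_def dist_quat_def uniformity_quat_def open_quat_def)+

end

instantiation quat :: real_normed_div_algebra
begin

definition inverse_quat :: "quat \<Rightarrow> quat" where
  "inverse_quat x = Quat (q1 x) (- qi x) (- qj x) (- qk x) /\<^sub>R (inner x x)"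

definition divide_quat :: "quat \<Rightarrow> quat \<Rightarrow> quat" where
  "divide_quat x y = x * inverse y"

instance
proof
  fix x y :: quat and r :: real
  have inv: "inverse x * x = 1 \<and> x * inverse x = 1" if "x \<noteq> 0"
  proof -
    define c where "c = Quat (q1 x) (- qi x) (- qj x) (- qk x)"
    have c: "c * x = inner x x *\<^sub>R 1" "x * c = inner x x *\<^sub>R 1"
      by (simp_all add: c_def quat_eq_iff inner_quat_def)
    have "inner x x \<noteq> 0" using that by (simp only: inner_eq_zero_iff not_False_eq_True)
    then show ?thesis
      unfolding inverse_quat_def c_def[symmetric] mult_scaleR_left mult_scaleR_right c scaleR_scaleR
      by (simp only: left_inverse scaleR_one simp_thms)
  qed
  show "x \<noteq> 0 \<Longrightarrow> inverse x * x = 1" "x \<noteq> 0 \<Longrightarrow> x * inverse x = 1"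
    using inv by auto
  show "x div y = x * inverse y"
    by (simp add: divide_quat_def)
  show "inverse (0 :: quat) = 0"
    by (simp add: inverse_quat_def inner_quat_def)
  have "inner (x * y) (x * y) = inner x x * inner y y"
    by (simp add: inner_quat_def algebra_simps)
  then show "norm (x * y) = norm x * norm y"
    by (simp add: norm_quat_def real_sqrt_mult)
qed

end

instantiation quat :: euclidean_space
begin

definition Basis_quat :: "quat set" where
  "Basis_quat = {Quat 1 0 0 0, Quat 0 1 0 0, Quat 0 0 1 0, Quat 0 0 0 1}"

instance
proof
  show "(Basis :: quat set) \<noteq> {}" "finite (Basis :: quat set)"
    by (simp_all add: Basis_quat_def)
next
  fix u v :: quat
  assume "u \<in> Basis" "v \<in> Basis"
  then show "inner u v = (if u = v then 1 else 0)"
    unfolding Basis_quat_def insert_iff empty_iff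
    by (elim disjE) (simp_all add: inner_quat_def)
next
  fix x :: quat
  show "(\<forall>u\<in>Basis. inner x u = 0) \<longleftrightarrow> x = 0"
    unfolding quat_eq_iff
    by (simp only: Basis_quat_def ball_simps inner_quat_def quat.sel) simp
qed

end

text \<open>
  The operations needed to speak uniformly about matrices over the three scalar algebras:
  conjugation and real part.
\<close>

class star_algebra = euclidean_space + real_normed_div_algebra +
  fixes star :: "'a \<Rightarrow> 'a"
    and real_part :: "'a \<Rightarrow> real"
  assumes star_add: "star (x + y) = star x + star y"
    and star_mult: "star (x * y) = star y * star x"
    and star_star: "star (star x) = x"
    and add_star: "x + star x = (2 * real_part x) *\<^sub>R 1"
    and inner_eq_real_part: "inner x y = real_part (x * star y)"

instantiation real :: star_algebra
begin

definition star_real :: "real \<Rightarrow> real" where "star_real x = x"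
definition real_part_real :: "real \<Rightarrow> real" where "real_part_real x = x"

instance
  by standard (simp_all add: star_real_def real_part_real_def)

end

instantiation complex :: star_algebra
begin

definition star_complex :: "complex \<Rightarrow> complex" where "star_complex = cnj"
definition real_part_complex :: "complex \<Rightarrow> real" where "real_part_complex = Re"

instance
  by standard (simp_all add: star_complex_def real_part_complex_def inner_complex_def complex_eq_iff)

end

instantiation quat :: star_algebra
begin

definition star_quat :: "quat \<Rightarrow> quat" where
  "star_quat x = Quat (q1 x) (- qi x) (- qj x) (- qk x)"

definition real_part_quat :: "quat \<Rightarrow> real" where "real_part_quat = q1"

instance
  by standard
    (simp_all add: star_quat_def real_part_quat_def inner_quat_def quat_eq_iff)

end


section \<open>Smooth maps between open subsets of Euclidean spaces\<close>

text \<open>Only meaningful for open \<open>S\<close>.\<close>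

primrec Ck_on :: "nat \<Rightarrow> ('a::euclidean_space \<Rightarrow> 'b::real_normed_vector) \<Rightarrow> 'a set \<Rightarrow> bool" where
  "Ck_on 0 f S \<longleftrightarrow> continuous_on S f"
| "Ck_on (Suc k) f S \<longleftrightarrow> (\<forall>x\<in>S. f differentiable (at x)) \<and>
     (\<forall>v. Ck_on k (\<lambda>x. frechet_derivative f (at x) v) S)"

definition smooth_on :: "'a set \<Rightarrow> ('a::euclidean_space \<Rightarrow> 'b::real_normed_vector) \<Rightarrow> bool" where
  "smooth_on S f \<longleftrightarrow> (\<forall>k. Ck_on k f S)"


section \<open>Riemannian manifolds\<close>

text \<open>
  A chart is a pair of its domain and its coordinate map; the values of the coordinate map outside
  the domain are irrelevant. A Riemannian metric is given by its coordinate expressions: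
  \<open>metric N c p u v\<close> is the inner product at the point \<open>p\<close> of the tangent vectors whose
  coordinates in the chart \<open>c\<close> are \<open>u\<close> and \<open>v\<close>.
\<close>

type_synonym ('a, 'e) chart = "'a set \<times> ('a \<Rightarrow> 'e)"

record ('a, 'e) rmanifold =
  mtop :: "'a topology"
  atlas :: "('a, 'e) chart set"
  metric :: "('a, 'e) chart \<Rightarrow> 'a \<Rightarrow> 'e \<Rightarrow> 'e \<Rightarrow> real"

definition chart_inv :: "('a, 'e) chart \<Rightarrow> 'e \<Rightarrow> 'a" where
  "chart_inv c = inv_into (fst c) (snd c)"

definition is_chart :: "'a topology \<Rightarrow> ('a, 'e::euclidean_space) chart \<Rightarrow> bool" where
  "is_chart X c \<longleftrightarrow> openin X (fst c) \<and> open (snd c ` fst c) \<and>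
     homeomorphic_map (subtopology X (fst c)) (top_of_set (snd c ` fst c)) (snd c)"

text \<open>
  The map \<open>f\<close> in the charts \<open>c\<close> of the source and \<open>d\<close> of the target: the set on which this
  expression makes sense, the expression, and its derivative at (the coordinates of) \<open>p\<close>.
\<close>

definition local_dom :: "('a, 'e) chart \<Rightarrow> ('b, 'h) chart \<Rightarrow> ('a \<Rightarrow> 'b) \<Rightarrow> 'e set" where
  "local_dom c d f = snd c ` {p \<in> fst c. f p \<in> fst d}"

definition local_rep :: "('a, 'e) chart \<Rightarrow> ('b, 'h) chart \<Rightarrow> ('a \<Rightarrow> 'b) \<Rightarrow> 'e \<Rightarrow> 'h" where
  "local_rep c d f = snd d \<circ> f \<circ> chart_inv c"

definition differential ::
  "('a, 'e::euclidean_space) chart \<Rightarrow> ('b, 'h::euclidean_space) chart \<Rightarrow> ('a \<Rightarrow> 'b) \<Rightarrow> 'a \<Rightarrow> 'e \<Rightarrow> 'h"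
  where "differential c d f p = frechet_derivative (local_rep c d f) (at (snd c p))"

definition smooth_manifold :: "('a, 'e::euclidean_space) rmanifold \<Rightarrow> bool" where
  "smooth_manifold N \<longleftrightarrow>
     Hausdorff_space (mtop N) \<and> second_countable (mtop N) \<and>
     (\<forall>c\<in>atlas N. is_chart (mtop N) c) \<and>
     (\<Union>c\<in>atlas N. fst c) = topspace (mtop N) \<and>
     (\<forall>c\<in>atlas N. \<forall>d\<in>atlas N. smooth_on (local_dom c d id) (local_rep c d id))"

definition riemannian_metric :: "('a, 'e::euclidean_space) rmanifold \<Rightarrow> bool" where
  "riemannian_metric N \<longleftrightarrow>
     (\<forall>c\<in>atlas N.
        (\<forall>p\<in>fst c. bilinear (metric N c p) \<and>
           (\<forall>u v. metric N c p u v = metric N c p v u) \<and>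
           (\<forall>u. u \<noteq> 0 \<longrightarrow> metric N c p u u > 0)) \<and>
        (\<forall>u v. smooth_on (snd c ` fst c) (\<lambda>x. metric N c (chart_inv c x) u v)) \<and>
        (\<forall>d\<in>atlas N. \<forall>p\<in>fst c \<inter> fst d. \<forall>u v.
           metric N c p u v = metric N d p (differential c d id p u) (differential c d id p v)))"

definition riemannian_manifold :: "('a, 'e::euclidean_space) rmanifold \<Rightarrow> bool" where
  "riemannian_manifold N \<longleftrightarrow> smooth_manifold N \<and> riemannian_metric N"

text \<open>Being orthogonal to the kernel of the differential of \<open>f\<close>.\<close>

definition horizontal ::
  "('a, 'e::euclidean_space) rmanifold \<Rightarrow> ('a, 'e) chart \<Rightarrow> ('b, 'h::euclidean_space) chart \<Rightarrow>
     ('a \<Rightarrow> 'b) \<Rightarrow> 'a \<Rightarrow> 'e \<Rightarrow> bool"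
  where "horizontal N c d f p u \<longleftrightarrow>
     (\<forall>w. differential c d f p w = 0 \<longrightarrow> metric N c p u w = 0)"

definition smooth_map ::
  "('a, 'e::euclidean_space) rmanifold \<Rightarrow> ('b, 'h::euclidean_space) rmanifold \<Rightarrow> ('a \<Rightarrow> 'b) \<Rightarrow> bool"
  where "smooth_map N P f \<longleftrightarrow> continuous_map (mtop N) (mtop P) f \<and>
     (\<forall>c\<in>atlas N. \<forall>d\<in>atlas P. smooth_on (local_dom c d f) (local_rep c d f))"

definition riemannian_submersion ::
  "('a, 'e::euclidean_space) rmanifold \<Rightarrow> ('b, 'h::euclidean_space) rmanifold \<Rightarrow> ('a \<Rightarrow> 'b) \<Rightarrow> bool"
  where "riemannian_submersion N P f \<longleftrightarrow>
     riemannian_manifold N \<and> riemannian_manifold P \<and> smooth_map N P f \<and>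
     (\<forall>c\<in>atlas N. \<forall>d\<in>atlas P. \<forall>p\<in>fst c. f p \<in> fst d \<longrightarrow>
        surj (differential c d f p) \<and>
        (\<forall>u v. horizontal N c d f p u \<and> horizontal N c d f p v \<longrightarrow>
           metric P d (f p) (differential c d f p u) (differential c d f p v) = metric N c p u v))"


section \<open>Quotients of Riemannian manifolds\<close>

definition quotient_topology :: "'a topology \<Rightarrow> ('a \<Rightarrow> 'b) \<Rightarrow> 'b topology" where
  "quotient_topology X f =
     topology (\<lambda>W. W \<subseteq> f ` topspace X \<and> openin X {x \<in> topspace X. f x \<in> W})"

lemma openin_quotient_topology:
  "openin (quotient_topology X f) W \<longleftrightarrow>
     W \<subseteq> f ` topspace X \<and> openin X {x \<in> topspace X. f x \<in> W}"
proof -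
  let ?L = "\<lambda>W. W \<subseteq> f ` topspace X \<and> openin X {x \<in> topspace X. f x \<in> W}"
  have "istopology ?L"
    unfolding istopology_def
  proof (intro conjI allI impI)
    fix S T assume S: "?L S" and T: "?L T"
    show "S \<inter> T \<subseteq> f ` topspace X" using S by blast
    have "{x \<in> topspace X. f x \<in> S \<inter> T} = {x \<in> topspace X. f x \<in> S} \<inter> {x \<in> topspace X. f x \<in> T}"
      by blast
    then show "openin X {x \<in> topspace X. f x \<in> S \<inter> T}" using S T by auto
  next
    fix \<K> assume K: "\<forall>W\<in>\<K>. ?L W"
    show "\<Union>\<K> \<subseteq> f ` topspace X" using K by blast
    have "{x \<in> topspace X. f x \<in> \<Union>\<K>} = (\<Union>W\<in>\<K>. {x \<in> topspace X. f x \<in> W})"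
      by blast
    then show "openin X {x \<in> topspace X. f x \<in> \<Union>\<K>}" using K by auto
  qed
  then show ?thesis
    by (simp add: quotient_topology_def topology_inverse')
qed

lemma topspace_quotient_topology: "topspace (quotient_topology X f) = f ` topspace X"
proof -
  have "{x \<in> topspace X. f x \<in> f ` topspace X} = topspace X" by blast
  then have "openin (quotient_topology X f) (f ` topspace X)"
    by (simp add: openin_quotient_topology)
  then show ?thesis
    using openin_subset openin_topspace[of "quotient_topology X f"]
    unfolding openin_quotient_topology[of X f "topspace (quotient_topology X f)"] by blast
qed

lemma quotient_map_quotient_topology: "quotient_map X (quotient_topology X f) f"
  by (auto simp: quotient_map_def topspace_quotient_topology openin_quotient_topology)

text \<open>
  The atlas of the quotient by \<open>f\<close> consists of all topological charts in which \<open>f\<close> is a smooth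
  submersion. If the quotient manifold exists, this is the maximal atlas of its unique smooth
  structure making \<open>f\<close> a submersion; that these charts cover and are smoothly compatible is not
  built into the definition. The quotient metric assigns to two tangent vectors the inner product
  of horizontal lifts of them; it is well defined iff that inner product does not depend on the
  point of the fibre.
\<close>

definition quotient_chart ::
  "('a, 'e::euclidean_space) rmanifold \<Rightarrow> ('a \<Rightarrow> 'b) \<Rightarrow> ('b, 'h::euclidean_space) chart \<Rightarrow> bool"
  where "quotient_chart N f d \<longleftrightarrow>
     is_chart (quotient_topology (mtop N) f) d \<and>
     (\<forall>c\<in>atlas N. smooth_on (local_dom c d f) (local_rep c d f) \<and>
        (\<forall>p\<in>fst c. f p \<in> fst d \<longrightarrow> surj (differential c d f p)))"

definition quotient_metric ::
  "('a, 'e::euclidean_space) rmanifold \<Rightarrow> ('a \<Rightarrow> 'b) \<Rightarrow>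
     ('b, 'h::euclidean_space) chart \<Rightarrow> 'b \<Rightarrow> 'h \<Rightarrow> 'h \<Rightarrow> real"
  where "quotient_metric N f d q u v =
     (THE r. \<forall>c\<in>atlas N. \<forall>p\<in>fst c. \<forall>u' v'.
        f p = q \<and> horizontal N c d f p u' \<and> differential c d f p u' = u \<and>
        horizontal N c d f p v' \<and> differential c d f p v' = v \<longrightarrow>
        metric N c p u' v' = r)"

definition quotient_rmanifold ::
  "('a, 'e::euclidean_space) rmanifold \<Rightarrow> ('a \<Rightarrow> 'b) \<Rightarrow> ('b, 'h::euclidean_space) rmanifold"
  where "quotient_rmanifold N f =
     \<lparr>mtop = quotient_topology (mtop N) f, atlas = {d. quotient_chart N f d},
      metric = quotient_metric N f\<rparr>"

definition euclidean_global_chart ::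
  "('a, 'e::euclidean_space) rmanifold \<Rightarrow> 'e set \<Rightarrow> ('e \<Rightarrow> 'a) \<Rightarrow> bool"
  where "euclidean_global_chart N S \<psi> \<longleftrightarrow>
     bij_betw \<psi> S (topspace (mtop N)) \<and>
     (let c = (topspace (mtop N), inv_into S \<psi>) in
        c \<in> atlas N \<and> (\<forall>p\<in>topspace (mtop N). \<forall>u v. metric N c p u v = inner u v))"


section \<open>Matrices with distinct nonzero singular values\<close>

text \<open>
  An \<open>n \<times> m\<close> matrix over the scalars \<open>'f\<close> has the type \<open>'f^'m^'n\<close>. Vectors are columns, with
  scalars acting from the right in the noncommutative case.
\<close>

type_synonym ('f, 'm, 'n) matrix = "'f^'m^'n"

definition conj_transpose :: "'f::star_algebra^'m^'n \<Rightarrow> 'f^'n^'m" where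
  "conj_transpose A = (\<chi> i j. star (A $ j $ i))"

definition unitary :: "('f::star_algebra^'k^'k) set" where
  "unitary = {U. U ** conj_transpose U = mat 1}"

definition frobenius :: "'f::star_algebra^'m^'n \<Rightarrow> 'f^'m^'n \<Rightarrow> real" where
  "frobenius A B = real_part (trace (A ** conj_transpose B))"

text \<open>
  The singular values are the square roots of the eigenvalues of \<open>M\<^sup>*M\<close>. The \<open>m\<close> singular values
  counted with multiplicity are pairwise distinct iff the set of singular values has \<open>m\<close> elements.
\<close>

definition singular_values :: "'f::star_algebra^'m^'n \<Rightarrow> real set" where
  "singular_values M =
     {s. s \<ge> 0 \<and> (\<exists>v. v \<noteq> 0 \<and> (conj_transpose M ** M) *v v = s\<^sup>2 *\<^sub>R v)}"

definition distinct_sv_matrices :: "('f::star_algebra^'m^'n) set" where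
  "distinct_sv_matrices = {M. card (singular_values M) = CARD('m) \<and> 0 \<notin> singular_values M}"

text \<open>An open subset of the space of matrices, with the identity as its only chart.\<close>

definition distinct_sv_manifold :: "('f::star_algebra^'m^'n, 'f^'m^'n) rmanifold" where
  "distinct_sv_manifold =
     \<lparr>mtop = top_of_set distinct_sv_matrices, atlas = {(distinct_sv_matrices, id)},
      metric = (\<lambda>c p. frobenius)\<rparr>"

definition action ::
  "('f::star_algebra^'n^'n) \<times> ('f^'m^'m) \<Rightarrow> 'f^'m^'n \<Rightarrow> 'f^'m^'n"
  where "action = (\<lambda>(U, V) M. U ** M ** conj_transpose V)"

definition orbit :: "'f::star_algebra^'m^'n \<Rightarrow> ('f^'m^'n) set" where
  "orbit M = {action k M | k. k \<in> unitary \<times> unitary}"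

definition orbit_manifold :: "(('f::star_algebra^'m^'n) set, real^'m) rmanifold" where
  "orbit_manifold = quotient_rmanifold distinct_sv_manifold orbit"

definition weyl_chamber :: "(real^'m::{finite,linorder}) set" where
  "weyl_chamber = {\<sigma>. (\<forall>i j. i < j \<longrightarrow> \<sigma> $ i > \<sigma> $ j) \<and> (\<forall>i. \<sigma> $ i > 0)}"

text \<open>
  Rows and columns are indexed by finite linear orders; the top block of an \<open>n \<times> m\<close> matrix is
  formed by its first \<open>m\<close> rows, so its diagonal consists of the entries whose row and column have
  the same position.
\<close>

definition position :: "'i::{finite,linorder} \<Rightarrow> nat" where
  "position i = card {..<i}"

definition top_diag ::
  "real^'m::{finite,linorder} \<Rightarrow> 'f::star_algebra^'m::{finite,linorder}^'n::{finite,linorder}"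
  where "top_diag \<sigma> = (\<chi> i j. if position i = position j then of_real (\<sigma> $ j) else 0)"

definition diag_orbit ::
  "real^'m::{finite,linorder} \<Rightarrow> ('f::star_algebra^'m::{finite,linorder}^'n::{finite,linorder}) set"
  where "diag_orbit \<sigma> = orbit (top_diag \<sigma>)"

end

theory Submission
  imports Defs
begin

text \<open>
  The proof works for any scalar algebra of class \<open>star_algebra\<close>, so the real, complex and
  quaternionic cases are one. Write \<open>S\<close> for the set of matrices with distinct nonzero singular
  values and \<open>sv M\<close> for the decreasing vector of singular values of \<open>M\<close>.

  By the singular value decomposition (\<open>svd\<close>) every \<open>M \<in> S\<close> is \<open>U \<Sigma> V\<^sup>*\<close> with \<open>\<Sigma>\<close> the top-diagonal
  matrix of \<open>sv M\<close>. Hence the fibres of \<open>sv\<close> on \<open>S\<close> are exactly the orbits (\<open>orbit_eq_iff\<close>), and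
  \<open>\<sigma> \<mapsto> top_diag \<sigma>\<close> is a linear section of \<open>sv\<close> over the Weyl chamber. The geometric content is the
  derivative of \<open>sv\<close>: if \<open>u\<^sub>i\<close>, \<open>v\<^sub>i\<close> are unit singular vectors for \<open>\<sigma>\<^sub>i\<close>, then
  \<open>D \<sigma>\<^sub>i(X) = \<langle>X, u\<^sub>i v\<^sub>i\<^sup>*\<rangle>\<close> (\<open>has_derivative_sv\<close>). The gradients \<open>u\<^sub>i v\<^sub>i\<^sup>*\<close> are orthonormal for the
  Frobenius metric (\<open>proj_rules\<close>), so \<open>D sv\<close> is surjective and maps the orthogonal complement of
  its kernel isometrically onto Euclidean space. That is the submersion property, and it makes the
  quotient metric Euclidean in the chart \<open>sv\<close>.

  Two analytic points need care, because over the quaternions singular values are not the simple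
  roots of a characteristic polynomial to which the implicit function theorem applies. Openness of
  \<open>S\<close> and continuity of \<open>sv\<close> (\<open>sv_near\<close>) come from the fact that an approximate eigenvector of a
  self-adjoint map forces a true eigenvalue nearby (\<open>eigenvalue_near\<close>). Smoothness
  (\<open>smooth_on_sv\<close>) is a bootstrap: Lagrange interpolation in \<open>M\<^sup>*M\<close> writes \<open>u\<^sub>i v\<^sub>i\<^sup>*\<close> as a rational
  expression in \<open>M\<close> and \<open>sv M\<close>, so the gradient of \<open>sv\<close> is as regular as \<open>sv\<close> itself, and \<open>sv\<close>
  is therefore one order more regular.

  What remains is independent of matrices: the locale \<open>submersion_with_section\<close> treats a quotient
  whose fibres are those of a smooth map with orthonormal gradients and a linear section. The atlas
  of the quotient consists of all charts in which the projection is a smooth submersion, so their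
  compatibility has to be proved; each of them differs from the chart \<open>sv\<close> by a diffeomorphism.
\<close>

section \<open>Calculus of iterated differentiability\<close>

text \<open>The derivatives of a function at a point of an open set depend only on its values on that
  set. Coordinate expressions are arbitrary outside their domains, and this lemma replaces them
  there by honest formulas.\<close>

lemma Ck_on_cong:
  fixes f :: "'a::euclidean_space \<Rightarrow> 'b::real_normed_vector"
  assumes "open S" and "\<And>x. x \<in> S \<Longrightarrow> f x = g x"
  shows "Ck_on k f S \<longleftrightarrow> Ck_on k g S"
  using assms(2)
proof (induction k arbitrary: f g)
  case 0
  then show ?case by (auto cong: continuous_on_cong)
next
  case (Suc k)
  have der: "(f has_derivative D) (at x) \<longleftrightarrow> (g has_derivative D) (at x)" if "x \<in> S" for x D
    using has_derivative_transform_within_open[OF _ \<open>open S\<close> that, of f D UNIV g]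
      has_derivative_transform_within_open[OF _ \<open>open S\<close> that, of g D UNIV f] Suc.prems by auto
  then have "frechet_derivative f (at x) = frechet_derivative g (at x)" if "x \<in> S" for x
    using that by (simp add: frechet_derivative_def)
  then have "Ck_on k (\<lambda>x. frechet_derivative f (at x) v) S
      \<longleftrightarrow> Ck_on k (\<lambda>x. frechet_derivative g (at x) v) S" for v
    by (intro Suc.IH) simp
  moreover have "f differentiable (at x) \<longleftrightarrow> g differentiable (at x)" if "x \<in> S" for x
    using der that by (simp add: differentiable_def)
  ultimately show ?case by simp
qed

lemma Ck_on_subset: "Ck_on k f S \<Longrightarrow> T \<subseteq> S \<Longrightarrow> Ck_on k f T"
  by (induction k arbitrary: f) (auto intro: continuous_on_subset)

lemma Ck_on_Suc_imp_Ck_on: "Ck_on (Suc k) f S \<Longrightarrow> Ck_on k f S"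
proof (induction k arbitrary: f)
  case 0
  then show ?case
    by (auto intro!: continuous_at_imp_continuous_on differentiable_imp_continuous_within)
qed auto

text \<open>The way to raise the order: a formula for the derivative, at the points of \<open>S\<close>, that is
  itself \<open>k\<close> times differentiable.\<close>

lemma Ck_on_SucI:
  fixes f :: "'a::euclidean_space \<Rightarrow> 'b::real_normed_vector"
  assumes "open S" and der: "\<And>x. x \<in> S \<Longrightarrow> (f has_derivative D x) (at x)"
    and "\<And>v. Ck_on k (\<lambda>x. D x v) S"
  shows "Ck_on (Suc k) f S"
proof -
  have "Ck_on k (\<lambda>x. frechet_derivative f (at x) v) S" for v
    using Ck_on_cong[OF \<open>open S\<close>, of "\<lambda>x. frechet_derivative f (at x) v" "\<lambda>x. D x v" k]
      frechet_derivative_at[OF der] assms(3) by simp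
  then show ?thesis using der by (auto simp: differentiable_def)
qed

lemma Ck_on_Suc_has_derivative:
  "Ck_on (Suc k) f S \<Longrightarrow> x \<in> S \<Longrightarrow> (f has_derivative frechet_derivative f (at x)) (at x)"
  by (simp add: frechet_derivative_works)

lemma Ck_on_const [simp]: "Ck_on k (\<lambda>x. c) S"
  by (induction k arbitrary: c) simp_all

lemma Ck_on_bounded_linear:
  assumes "bounded_linear f" "open S"
  shows "Ck_on k f S"
proof (cases k)
  case 0
  then show ?thesis using assms by (simp add: linear_continuous_on)
next
  case (Suc l)
  show ?thesis unfolding Suc
    by (rule Ck_on_SucI[OF \<open>open S\<close> bounded_linear_imp_has_derivative[OF assms(1)]]) simp
qed

lemma Ck_on_ident: "open S \<Longrightarrow> Ck_on k (\<lambda>x. x) S"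
  by (simp add: Ck_on_bounded_linear bounded_linear_ident)

lemma Ck_on_add:
  assumes "open S" "Ck_on k f S" "Ck_on k g S"
  shows "Ck_on k (\<lambda>x. f x + g x) S"
  using assms(2,3)
proof (induction k arbitrary: f g)
  case 0
  then show ?case by (simp add: continuous_on_add)
next
  case (Suc k)
  show ?case
    using Suc
    by (intro Ck_on_SucI[OF \<open>open S\<close> has_derivative_add[OF
            Ck_on_Suc_has_derivative[OF Suc.prems(1)] Ck_on_Suc_has_derivative[OF Suc.prems(2)]]]) auto
qed

lemma Ck_on_sum:
  assumes "open S" "\<And>i. i \<in> I \<Longrightarrow> Ck_on k (f i) S"
  shows "Ck_on k (\<lambda>x. \<Sum>i\<in>I. f i x) S"
  using assms(2)
  by (induction I rule: infinite_finite_induct) (simp_all add: Ck_on_add[OF \<open>open S\<close>])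

lemma Ck_on_bilinear:
  assumes p: "bounded_bilinear p" and "open S" "Ck_on k f S" "Ck_on k g S"
  shows "Ck_on k (\<lambda>x. p (f x) (g x)) S"
  using assms(3,4)
proof (induction k arbitrary: f g)
  case 0
  then show ?case using bounded_bilinear.continuous_on[OF p] by simp
next
  case (Suc k)
  have "Ck_on k f S" "Ck_on k g S" using Suc.prems Ck_on_Suc_imp_Ck_on by auto
  then have "Ck_on k (\<lambda>x. p (f x) (frechet_derivative g (at x) v)
      + p (frechet_derivative f (at x) v) (g x)) S" for v
    using Suc by (intro Ck_on_add[OF \<open>open S\<close>]) auto
  then show ?case
    by (intro Ck_on_SucI[OF \<open>open S\<close> bounded_bilinear.FDERIV[OF p
            Ck_on_Suc_has_derivative[OF Suc.prems(1)] Ck_on_Suc_has_derivative[OF Suc.prems(2)]]]) auto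
qed

lemma Ck_on_linear_image:
  assumes L: "bounded_linear L" and "open S" "Ck_on k f S"
  shows "Ck_on k (\<lambda>x. L (f x)) S"
  using assms(3)
proof (induction k arbitrary: f)
  case 0
  then show ?case using bounded_linear.continuous_on[OF L] by simp
next
  case (Suc k)
  show ?case
    using Suc
    by (intro Ck_on_SucI[OF \<open>open S\<close> bounded_linear.has_derivative[OF L
            Ck_on_Suc_has_derivative[OF Suc.prems]]]) auto
qed

lemma Ck_on_prod:
  fixes f :: "'i \<Rightarrow> 'a::euclidean_space \<Rightarrow> real"
  assumes "open S" "\<And>i. i \<in> I \<Longrightarrow> Ck_on k (f i) S"
  shows "Ck_on k (\<lambda>x. \<Prod>i\<in>I. f i x) S"
  using assms(2)
  by (induction I rule: infinite_finite_induct)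
    (simp_all add: Ck_on_bilinear[OF bounded_bilinear_mult \<open>open S\<close>])

text \<open>The derivative of \<open>1 / f\<close> is a product of \<open>1 / f\<close> (twice) and the derivative of \<open>f\<close>, so the
  claim for order \<open>k\<close> yields that for order \<open>k + 1\<close>.\<close>

lemma Ck_on_inverse:
  fixes f :: "'a::euclidean_space \<Rightarrow> real"
  assumes "open S" "Ck_on k f S" and nz: "\<And>x. x \<in> S \<Longrightarrow> f x \<noteq> 0"
  shows "Ck_on k (\<lambda>x. inverse (f x)) S"
  using assms(2)
proof (induction k)
  case 0
  then show ?case using nz by (simp add: continuous_on_inverse)
next
  case (Suc k)
  have "Ck_on k (\<lambda>x. inverse (f x)) S" using Suc Ck_on_Suc_imp_Ck_on by blast
  then have "Ck_on k (\<lambda>x. (- 1) * (inverse (f x) * frechet_derivative f (at x) v * inverse (f x))) S" for v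
    using Suc.prems by (intro Ck_on_bilinear[OF bounded_bilinear_mult \<open>open S\<close>]) auto
  then show ?case
    by (intro Ck_on_SucI[OF \<open>open S\<close> Deriv.has_derivative_inverse[OF nz
            Ck_on_Suc_has_derivative[OF Suc.prems]]]) auto
qed

text \<open>The chain rule expresses the derivative of the composition in terms of the partial
  derivatives of the outer map, which are again composed with the inner map; hence the induction.\<close>

lemma Ck_on_compose:
  fixes f :: "'a::euclidean_space \<Rightarrow> 'b::euclidean_space" and g :: "'b \<Rightarrow> 'c::real_normed_vector"
  assumes "open S" "open T" "f ` S \<subseteq> T" "Ck_on k f S" "Ck_on k g T"
  shows "Ck_on k (\<lambda>x. g (f x)) S"
  using assms(4,5)
proof (induction k arbitrary: g)
  case 0
  then show ?case using \<open>f ` S \<subseteq> T\<close> by (auto intro: continuous_on_compose2)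
next
  case (Suc k)
  have f: "Ck_on k f S" using Suc.prems Ck_on_Suc_imp_Ck_on by blast
  let ?D = "\<lambda>x v. \<Sum>b\<in>Basis. (frechet_derivative f (at x) v \<bullet> b) *\<^sub>R frechet_derivative g (at (f x)) b"
  have "Ck_on k (\<lambda>x. frechet_derivative g (at (f x)) b) S" for b
    using Suc.IH[of "\<lambda>y. frechet_derivative g (at y) b"] Suc.prems f by simp
  then have "Ck_on k (\<lambda>x. ?D x v) S" for v
    using Suc.prems
    by (intro Ck_on_sum Ck_on_bilinear[OF bounded_bilinear_scaleR]
        Ck_on_linear_image[OF bounded_linear_inner_left] \<open>open S\<close>) auto
  moreover have "((\<lambda>x. g (f x)) has_derivative ?D x) (at x)" if "x \<in> S" for x
  proof -
    have g: "(g has_derivative frechet_derivative g (at (f x))) (at (f x))"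
      using Suc.prems(2) that \<open>f ` S \<subseteq> T\<close> by (intro Ck_on_Suc_has_derivative) auto
    have "((\<lambda>x. g (f x)) has_derivative
        (\<lambda>v. frechet_derivative g (at (f x)) (frechet_derivative f (at x) v))) (at x)"
      using diff_chain_at[OF Ck_on_Suc_has_derivative[OF Suc.prems(1) that] g] by (simp add: o_def)
    moreover have *: "frechet_derivative g (at (f x)) w
        = (\<Sum>b\<in>Basis. (w \<bullet> b) *\<^sub>R frechet_derivative g (at (f x)) b)" for w
      using linear_sum[of "frechet_derivative g (at (f x))" "\<lambda>b. (w \<bullet> b) *\<^sub>R b" Basis]
        has_derivative_linear[OF g] by (simp add: euclidean_representation linear_scale)
    have "(\<lambda>v. frechet_derivative g (at (f x)) (frechet_derivative f (at x) v)) = ?D x"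
      by (rule ext) (rule *)
    ultimately show ?thesis by (simp only:)
  qed
  ultimately show ?case by (intro Ck_on_SucI[OF \<open>open S\<close>])
qed

lemma Ck_on_vec:
  fixes f :: "'i::finite \<Rightarrow> 'a::euclidean_space \<Rightarrow> real"
  assumes "open S" "\<And>i. Ck_on k (f i) S"
  shows "Ck_on k (\<lambda>x. \<chi> i. f i x) S"
proof -
  have "(\<chi> i. f i x) = (\<Sum>i\<in>UNIV. f i x *\<^sub>R axis i (1::real))" for x
    by (simp add: vec_eq_iff axis_def if_distrib cong: if_cong)
  moreover have "Ck_on k (\<lambda>x. \<Sum>i\<in>UNIV. f i x *\<^sub>R axis i (1::real)) S"
    by (intro Ck_on_sum Ck_on_bilinear[OF bounded_bilinear_scaleR] assms) simp
  ultimately show ?thesis by simp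
qed

lemma Ck_on_det:
  fixes a :: "'m::finite \<Rightarrow> 'm \<Rightarrow> 'a::euclidean_space \<Rightarrow> real"
  assumes "open S" "\<And>i j. Ck_on k (a i j) S"
  shows "Ck_on k (\<lambda>x. det (\<chi> i j. a i j x)) S"
  unfolding det_def vec_lambda_beta
  by (intro Ck_on_sum Ck_on_bilinear[OF bounded_bilinear_mult] Ck_on_prod assms) simp

lemma smooth_on_cong:
  "open S \<Longrightarrow> (\<And>x. x \<in> S \<Longrightarrow> f x = g x) \<Longrightarrow> smooth_on S f \<longleftrightarrow> smooth_on S g"
  unfolding smooth_on_def using Ck_on_cong by blast

lemma smooth_on_subset: "smooth_on S f \<Longrightarrow> T \<subseteq> S \<Longrightarrow> smooth_on T f"
  unfolding smooth_on_def using Ck_on_subset by blast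

lemma smooth_on_compose:
  fixes f :: "'a::euclidean_space \<Rightarrow> 'b::euclidean_space" and g :: "'b \<Rightarrow> 'c::real_normed_vector"
  assumes "open S" "open T" "f ` S \<subseteq> T" "smooth_on S f" "smooth_on T g"
  shows "smooth_on S (\<lambda>x. g (f x))"
  using assms unfolding smooth_on_def by (blast intro: Ck_on_compose)

lemma smooth_on_has_derivative:
  "smooth_on S f \<Longrightarrow> x \<in> S \<Longrightarrow> (f has_derivative frechet_derivative f (at x)) (at x)"
  unfolding smooth_on_def using Ck_on_Suc_has_derivative by blast

lemma smooth_on_frechet_derivative:
  "smooth_on S f \<Longrightarrow> smooth_on S (\<lambda>x. frechet_derivative f (at x) v)"
  unfolding smooth_on_def by (metis Ck_on.simps(2))

text \<open>The derivative of the inverse map at \<open>y\<close> solves a linear system whose coefficients are the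
  partial derivatives of \<open>g\<close> at \<open>h y\<close>. By Cramer's rule it is a rational expression in them, so it
  is as often differentiable as \<open>h\<close> itself; this gains one order of differentiability for \<open>h\<close>.\<close>

lemma smooth_on_inverse_map:
  fixes g h :: "real^'m \<Rightarrow> real^'m"
  assumes "open A" "open B" and h: "continuous_on A h" "h ` A \<subseteq> B"
    and gh: "\<And>y. y \<in> A \<Longrightarrow> g (h y) = y"
    and g: "smooth_on B g" and inj: "\<And>x. x \<in> B \<Longrightarrow> inj (frechet_derivative g (at x))"
  shows "smooth_on A h"
proof -
  let ?G = "\<lambda>y. frechet_derivative g (at (h y))"
  define M where "M y = matrix (?G y)" for y
  define D where "D y v = (\<chi> k. det (\<chi> i j. if j = k then v $ i else M y $ i $ j) * inverse (det (M y)))"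
    for y v
  have derg: "(g has_derivative ?G y) (at (h y))" if "y \<in> A" for y
    using smooth_on_has_derivative[OF g] h(2) that by auto
  then have lin: "linear (?G y)" if "y \<in> A" for y
    using that has_derivative_linear by blast
  have det: "det (M y) \<noteq> 0" if "y \<in> A" for y
  proof -
    have "inj (?G y)" using inj h(2) that by auto
    then show ?thesis
      using lin[OF that] det_nz_iff_inj[of "?G y"] by (simp add: M_def)
  qed
  have solve: "?G y u = v \<longleftrightarrow> u = D y v" if "y \<in> A" for y u v
  proof -
    have "?G y u = M y *v u" using lin[OF that] by (simp add: M_def matrix_works)
    then show ?thesis using cramer[OF det[OF that], of u v] by (simp add: D_def divide_inverse)
  qed
  have derh: "(h has_derivative D y) (at y)" if "y \<in> A" for y
  proof (rule has_derivative_inverse_basic[OF derg[OF that] _ _ _ \<open>open A\<close> that gh])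
    have GD: "?G y (D y v) = v" for v using solve[OF that] by blast
    have "linear (D y)"
    proof (rule linearI)
      show "D y (v + w) = D y v + D y w" for v w
        using solve[OF that, of "D y v + D y w" "v + w"] GD linear_add[OF lin[OF that]] by simp
      show "D y (c *\<^sub>R v) = c *\<^sub>R D y v" for c v
        using solve[OF that, of "c *\<^sub>R D y v" "c *\<^sub>R v"] GD linear_scale[OF lin[OF that]] by simp
    qed
    then show "bounded_linear (D y)" by (simp add: linear_conv_bounded_linear)
    show "D y \<circ> ?G y = id"
      using solve[OF that] by (intro ext) (metis comp_apply id_apply)
    show "continuous (at y) h"
      using h(1) \<open>open A\<close> that by (simp add: continuous_on_eq_continuous_at)
  qed
  have "Ck_on k h A" for k
  proof (induction k)
    case 0
    then show ?case using h by simp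
  next
    case (Suc k)
    have M: "Ck_on k (\<lambda>y. M y $ i $ j) A" for i j
    proof -
      have "Ck_on k (\<lambda>y. ?G y (axis j 1)) A"
        using Ck_on_compose[OF \<open>open A\<close> \<open>open B\<close> h(2) Suc, of "\<lambda>x. frechet_derivative g (at x) (axis j 1)"]
          smooth_on_frechet_derivative[OF g] by (simp add: smooth_on_def)
      then show ?thesis
        unfolding M_def matrix_def by (simp add: Ck_on_linear_image[OF bounded_linear_vec_nth \<open>open A\<close>])
    qed
    have "Ck_on k (\<lambda>y. D y v) A" for v
      unfolding D_def
    proof (intro Ck_on_vec Ck_on_bilinear[OF bounded_bilinear_mult] Ck_on_inverse Ck_on_det \<open>open A\<close>)
      have "Ck_on k (\<lambda>y. det (\<chi> i j. M y $ i $ j)) A" by (intro Ck_on_det M \<open>open A\<close>)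
      then show "Ck_on k (\<lambda>y. det (M y)) A" by simp
      show "Ck_on k (\<lambda>y. if j = l then v $ i else M y $ i $ j) A" for i j l
        by (cases "j = l") (simp_all add: M)
    qed (use det in auto)
    then show ?case using derh by (intro Ck_on_SucI[OF \<open>open A\<close>])
  qed
  then show ?thesis by (simp add: smooth_on_def)
qed

text \<open>Caratheodory's form of differentiability: the increment is exactly linear in \<open>y - x\<close>, with a
  gradient that may depend on \<open>y\<close> but converges.\<close>

lemma caratheodory_derivative:
  fixes f :: "'a::real_inner \<Rightarrow> real"
  assumes "\<forall>\<^sub>F y in at x. f y - f x = inner (y - x) (H y)" and H: "(H \<longlongrightarrow> p) (at x)"
  shows "(f has_derivative (\<lambda>v. inner v p)) (at x)"
  unfolding has_derivative_iff_norm
proof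
  show "bounded_linear (\<lambda>v. inner v p)" by (rule bounded_linear_inner_left)
  show "((\<lambda>y. norm (f y - f x - inner (y - x) p) / norm (y - x)) \<longlongrightarrow> 0) (at x)"
  proof (rule Lim_null_comparison)
    show "((\<lambda>y. norm (H y - p)) \<longlongrightarrow> 0) (at x)"
      using H by (simp add: tendsto_norm_zero_iff LIM_zero_iff)
    show "\<forall>\<^sub>F y in at x. norm (norm (f y - f x - inner (y - x) p) / norm (y - x)) \<le> norm (H y - p)"
      using assms(1)
    proof (rule eventually_mono)
      fix y assume "f y - f x = inner (y - x) (H y)"
      then have "norm (f y - f x - inner (y - x) p) = \<bar>inner (y - x) (H y - p)\<bar>"
        by (simp add: inner_diff_right)
      also have "\<dots> \<le> norm (y - x) * norm (H y - p)" by (rule Cauchy_Schwarz_ineq2)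
      finally show "norm (norm (f y - f x - inner (y - x) p) / norm (y - x)) \<le> norm (H y - p)"
        by (cases "y = x") (simp_all add: divide_le_eq mult.commute)
    qed
  qed
qed

lemma has_derivative_vec:
  fixes f :: "'i::finite \<Rightarrow> 'a::real_normed_vector \<Rightarrow> real"
  assumes "\<And>i. (f i has_derivative f' i) F"
  shows "((\<lambda>x. \<chi> i. f i x) has_derivative (\<lambda>v. \<chi> i. f' i v)) F"
proof -
  have vec: "(\<chi> i. a i) = (\<Sum>i\<in>UNIV. a i *\<^sub>R axis i (1::real))" for a :: "'i \<Rightarrow> real"
    by (simp add: vec_eq_iff axis_def if_distrib cong: if_cong)
  show ?thesis
    unfolding vec by (intro has_derivative_sum has_derivative_scaleR_left assms)
qed

section \<open>Quotients by submersions with a global section\<close>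

lemma second_countable_UNIV: "second_countable (euclidean :: 'a::second_countable_topology topology)"
proof -
  obtain \<B> :: "'a set set" where \<B>: "countable \<B>" "topological_basis \<B>"
    using ex_countable_basis by auto
  show ?thesis
    unfolding second_countable_def
  proof (intro exI[of _ \<B>] conjI ballI allI impI)
    fix T :: "'a set" and x assume "openin euclidean T \<and> x \<in> T"
    then show "\<exists>V\<in>\<B>. x \<in> V \<and> V \<subseteq> T"
      using topological_basisE[OF \<B>(2), of T x] by auto
  qed (use \<B> topological_basis_open in auto)
qed

text \<open>
  The map \<open>f\<close> is the projection to the quotient, and \<open>s\<close> gives coordinates on it with values in \<open>W\<close>;
  \<open>t\<close> is a section of \<open>s\<close>. It is linear and hence smooth. The \<open>P x i\<close>
  are the gradients of the components of \<open>s\<close>; their orthonormality says that the derivative of \<open>s\<close> is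
  an orthogonal projection followed by an isometry.
\<close>

locale submersion_with_section =
  fixes S :: "'e::euclidean_space set" and f :: "'e \<Rightarrow> 'b"
    and s :: "'e \<Rightarrow> real^'m" and W :: "(real^'m) set" and t :: "real^'m \<Rightarrow> 'e"
    and P :: "'e \<Rightarrow> 'm \<Rightarrow> 'e"
  assumes open_S: "open S" and open_W: "open W"
    and smooth_s: "smooth_on S s" and s_W: "x \<in> S \<Longrightarrow> s x \<in> W"
    and lin_t: "bounded_linear t" and t_S: "w \<in> W \<Longrightarrow> t w \<in> S" and s_t: "w \<in> W \<Longrightarrow> s (t w) = w"
    and fibres: "x \<in> S \<Longrightarrow> y \<in> S \<Longrightarrow> f x = f y \<longleftrightarrow> s x = s y"
    and der_s: "x \<in> S \<Longrightarrow> (s has_derivative (\<lambda>X. \<chi> i. X \<bullet> P x i)) (at x)"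
    and orth: "x \<in> S \<Longrightarrow> P x i \<bullet> P x j = (if i = j then 1 else 0)"
begin

abbreviation id_chart :: "('e, 'e) chart" where "id_chart \<equiv> (S, id)"

definition N :: "('e, 'e) rmanifold" where
  "N = \<lparr>mtop = top_of_set S, atlas = {id_chart}, metric = (\<lambda>c p. inner)\<rparr>"

definition Q :: "('b, real^'m) rmanifold" where "Q = quotient_rmanifold N f"

lemma N_simps [simp]: "mtop N = top_of_set S" "atlas N = {id_chart}" "metric N = (\<lambda>c p. inner)"
  by (simp_all add: N_def)

lemma Q_simps: "mtop Q = quotient_topology (top_of_set S) f" "atlas Q = {d. quotient_chart N f d}"
    "metric Q = quotient_metric N f"
  by (simp_all add: Q_def quotient_rmanifold_def)

lemma topspace_Q: "topspace (mtop Q) = f ` S"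
  by (simp add: Q_simps topspace_quotient_topology)

lemma chart_inv_id: "x \<in> S \<Longrightarrow> chart_inv id_chart x = x"
  using inv_into_f_f[of id S x] by (simp add: chart_inv_def)

definition ds :: "'e \<Rightarrow> 'e \<Rightarrow> real^'m" where "ds x X = (\<chi> i. X \<bullet> P x i)"

text \<open>The adjoint of \<open>ds x\<close>; it lifts tangent vectors of the quotient to horizontal ones.\<close>

definition lift :: "'e \<Rightarrow> real^'m \<Rightarrow> 'e" where "lift x u = (\<Sum>i\<in>UNIV. u $ i *\<^sub>R P x i)"

lemma der_ds: "x \<in> S \<Longrightarrow> (s has_derivative ds x) (at x)"
  using der_s by (simp add: ds_def[abs_def])

lemma linear_ds: "x \<in> S \<Longrightarrow> linear (ds x)"
  using der_ds has_derivative_linear by blast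

lemma ds_lift: "x \<in> S \<Longrightarrow> ds x (lift x u) = u"
  by (simp add: ds_def lift_def vec_eq_iff inner_sum_left orth if_distrib cong: if_cong)

lemma lift_inner: "lift x u \<bullet> w = u \<bullet> ds x w"
  by (simp add: ds_def lift_def inner_sum_left inner_vec_def inner_commute[of w])

text \<open>The vector \<open>u - lift x (ds x u)\<close> lies in the kernel of \<open>ds x\<close>, hence is orthogonal to \<open>u\<close> and
  to every lift. So it is orthogonal to itself and vanishes: horizontal vectors are lifts, and
  \<open>lift x\<close> is adjoint to \<open>ds x\<close>.\<close>

lemma horizontal_isometry:
  assumes "x \<in> S" and u: "\<And>w. ds x w = 0 \<Longrightarrow> u \<bullet> w = 0"
  shows "ds x u \<bullet> ds x v = u \<bullet> v"
proof -
  have "ds x (u - lift x (ds x u)) = 0"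
    using linear_ds[OF assms(1)] ds_lift[OF assms(1)] by (simp add: linear_diff)
  then have "u \<bullet> (u - lift x (ds x u)) = 0" "lift x (ds x u) \<bullet> (u - lift x (ds x u)) = 0"
    using u lift_inner by simp_all
  then have "(u - lift x (ds x u)) \<bullet> (u - lift x (ds x u)) = 0"
    by (simp add: inner_diff_left)
  then have "u = lift x (ds x u)" by simp
  then show ?thesis by (metis lift_inner)
qed

lemma riemannian_manifold_N: "riemannian_manifold N"
proof -
  have "smooth_on S (\<lambda>x. x)" by (simp add: smooth_on_def Ck_on_ident open_S)
  then have "smooth_on S (local_rep id_chart id_chart id)"
    by (subst smooth_on_cong[OF open_S, where g = "\<lambda>x. x"]) (simp_all add: local_rep_def chart_inv_id)
  moreover have "local_dom id_chart id_chart id = S" by (auto simp: local_dom_def)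
  moreover have "is_chart (top_of_set S) id_chart"
    using open_S by (simp add: is_chart_def subtopology_subtopology)
  ultimately have "smooth_manifold N"
    by (simp add: smooth_manifold_def Hausdorff_space_subtopology second_countable_subtopology
        Hausdorff_space_euclidean second_countable_UNIV)
  moreover have "differential id_chart id_chart id x u = u" if "x \<in> S" for x u
  proof -
    have "(local_rep id_chart id_chart id has_derivative (\<lambda>v. v)) (at x)"
      by (rule has_derivative_transform_within_open[OF has_derivative_ident open_S that])
        (simp add: local_rep_def chart_inv_id)
    then show ?thesis
      by (simp add: differential_def frechet_derivative_at[symmetric])
  qed
  ultimately show ?thesis
    by (simp add: riemannian_manifold_def riemannian_metric_def bilinear_def linear_iff
        inner_add_left inner_add_right inner_commute smooth_on_def)
qed

subsection \<open>The chart given by the section\<close>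

definition s0 :: "'b \<Rightarrow> real^'m" where "s0 = inv_into W (f \<circ> t)"

lemma inj_on_f_t: "inj_on (f \<circ> t) W"
  by (rule inj_onI) (metis comp_apply fibres s_t t_S)

lemma f_t_s: "x \<in> S \<Longrightarrow> f (t (s x)) = f x"
  by (simp add: fibres t_S s_W s_t)

lemma s0_f: "x \<in> S \<Longrightarrow> s0 (f x) = s x"
  using inv_into_f_f[OF inj_on_f_t s_W, of x] by (simp add: s0_def f_t_s)

lemma f_t_image: "(f \<circ> t) ` W = f ` S"
  using t_S f_t_s s_W by (force simp: image_iff)

lemma continuous_s: "continuous_on S s"
  using smooth_s unfolding smooth_on_def by (metis Ck_on.simps(1))

text \<open>Continuity of \<open>s0\<close> is that of \<open>s = s0 \<circ> f\<close>, by the universal property of the quotient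
  topology; its inverse \<open>f \<circ> t\<close> is continuous because \<open>t\<close> is.\<close>

lemma homeomorphic_maps_s0: "homeomorphic_maps (mtop Q) (top_of_set W) s0 (f \<circ> t)"
proof -
  have q: "quotient_map (top_of_set S) (mtop Q) f"
    unfolding Q_simps by (rule quotient_map_quotient_topology)
  have "continuous_map (top_of_set S) (top_of_set W) (s0 \<circ> f)"
    using continuous_s s_W by (auto simp: s0_f cong: continuous_on_cong)
  then have "continuous_map (mtop Q) (top_of_set W) s0"
    using continuous_compose_quotient_map[OF q] by blast
  moreover have "continuous_map (top_of_set W) (top_of_set S) t"
    using t_S by (auto intro: linear_continuous_on lin_t)
  then have "continuous_map (top_of_set W) (mtop Q) (f \<circ> t)"
    using q quotient_imp_continuous_map continuous_map_compose by blast
  ultimately show ?thesis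
    by (auto simp: homeomorphic_maps_def topspace_Q s0_f f_t_s s_t t_S)
qed

lemma chart_s0: "quotient_chart N f (f ` S, s0)"
proof -
  have im: "s0 ` f ` S = W" using s_W s_t t_S by (force simp: s0_f image_iff)
  have "homeomorphic_map (mtop Q) (top_of_set W) s0"
    using homeomorphic_maps_s0 homeomorphic_map_maps by blast
  then have "is_chart (mtop Q) (f ` S, s0)"
    using open_W im subtopology_topspace[of "mtop Q"] openin_topspace[of "mtop Q"]
    by (simp add: is_chart_def topspace_Q)
  moreover have rep: "local_rep id_chart (f ` S, s0) f x = s x" if "x \<in> S" for x
    using that by (simp add: local_rep_def chart_inv_id s0_f)
  moreover have "local_dom id_chart (f ` S, s0) f = S"
    by (auto simp: local_dom_def)
  moreover have "surj (differential id_chart (f ` S, s0) f x)" if "x \<in> S" for x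
  proof -
    have "(local_rep id_chart (f ` S, s0) f has_derivative ds x) (at x)"
      by (rule has_derivative_transform_within_open[OF der_ds[OF that] open_S that]) (simp add: rep)
    then have "differential id_chart (f ` S, s0) f x = ds x"
      by (simp add: differential_def frechet_derivative_at[symmetric])
    then show ?thesis using ds_lift[OF that] by (metis surjI)
  qed
  ultimately show ?thesis
    using smooth_s smooth_on_cong[OF open_S rep] by (simp add: quotient_chart_def Q_simps)
qed

end

subsection \<open>Arbitrary charts\<close>

text \<open>
  For a chart \<open>d\<close> of the quotient, \<open>g\<close> and \<open>h\<close> are the two transition maps between the chart \<open>s0\<close> and
  \<open>d\<close>, defined on the open sets \<open>B\<close> and \<open>A\<close>; \<open>R\<close> is the part of \<open>S\<close> that lies over \<open>d\<close>. Smoothness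
  of \<open>g\<close> comes from \<open>g = (snd d \<circ> f) \<circ> t\<close>. Conversely \<open>snd d \<circ> f = g \<circ> s\<close> on \<open>R\<close>, so \<open>g\<close> inherits
  a surjective derivative from the submersion \<open>snd d \<circ> f\<close>, and \<open>h\<close> is smooth as its continuous
  inverse.
\<close>

locale chart_of_quotient = submersion_with_section S f s W t P
  for S :: "'e::euclidean_space set" and f :: "'e \<Rightarrow> 'b"
    and s :: "'e \<Rightarrow> real^'m" and W t P +
  fixes d :: "('b, real^'m) chart"
  assumes chart: "quotient_chart N f d"
begin

definition g :: "real^'m \<Rightarrow> real^'m" where "g w = snd d (f (t w))"
definition h :: "real^'m \<Rightarrow> real^'m" where "h y = s0 (chart_inv d y)"
definition A :: "(real^'m) set" where "A = snd d ` fst d"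
definition B :: "(real^'m) set" where "B = {w \<in> W. f (t w) \<in> fst d}"
definition R :: "'e set" where "R = {x \<in> S. f x \<in> fst d}"

definition Dg where "Dg w = frechet_derivative g (at w)"
definition Dh where "Dh y = frechet_derivative h (at y)"

lemma is_chart: "is_chart (mtop Q) d"
  using chart by (simp add: quotient_chart_def Q_simps)

lemma open_A: "open A"
  using is_chart by (simp add: is_chart_def A_def)

lemma fst_d: "fst d \<subseteq> f ` S"
  using is_chart openin_subset topspace_Q by (fastforce simp: is_chart_def)

lemma open_R: "open R"
proof -
  have "openin (top_of_set S) R"
    using is_chart by (simp add: is_chart_def Q_simps openin_quotient_topology R_def)
  then show ?thesis using openin_open_eq[OF open_S] by blast
qed

lemma open_B: "open B"
proof -
  have "B = W \<inter> t -` R" using t_S by (auto simp: B_def R_def)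
  moreover have "continuous_on UNIV t" using lin_t linear_continuous_on by blast
  ultimately show ?thesis using open_Int[OF open_W open_vimage[OF open_R]] by simp
qed

lemma topspace_chart: "topspace (subtopology (mtop Q) (fst d)) = fst d"
  using fst_d topspace_Q by auto

lemma inj_d: "inj_on (snd d) (fst d)"
  using is_chart homeomorphic_imp_injective_map topspace_chart by (fastforce simp: is_chart_def)

lemma chart_inv_d: "q \<in> fst d \<Longrightarrow> chart_inv d (snd d q) = q"
  using inj_d by (simp add: chart_inv_def)

lemma s_B: "x \<in> R \<Longrightarrow> s x \<in> B"
  by (auto simp: R_def B_def s_W f_t_s)

lemma t_R: "w \<in> B \<Longrightarrow> t w \<in> R"
  by (auto simp: R_def B_def t_S)

lemma B_sub: "w \<in> B \<Longrightarrow> w \<in> W"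
  by (auto simp: B_def)

lemma g_s: "x \<in> R \<Longrightarrow> g (s x) = snd d (f x)"
  by (auto simp: R_def g_def f_t_s)

lemma g_A: "w \<in> B \<Longrightarrow> g w \<in> A"
  by (auto simp: A_def B_def g_def)

lemma h_g: "w \<in> B \<Longrightarrow> h (g w) = w"
  by (auto simp: B_def h_def g_def chart_inv_d s0_f t_S s_t)

lemma A_E:
  assumes "y \<in> A"
  obtains w where "w \<in> B" "y = g w"
proof -
  obtain q where q: "q \<in> fst d" "y = snd d q" using assms by (auto simp: A_def)
  then obtain x where "x \<in> S" "q = f x" using fst_d by auto
  then have "x \<in> R" "y = snd d (f x)" using q by (auto simp: R_def)
  then show ?thesis using that g_s s_B by metis
qed

lemma g_h: "y \<in> A \<Longrightarrow> g (h y) = y"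
  by (metis A_E h_g)

lemma h_B: "y \<in> A \<Longrightarrow> h y \<in> B"
  by (metis A_E h_g)

lemma chart_inv_h: "y \<in> A \<Longrightarrow> chart_inv d y = f (t (h y))"
  using h_B[of y] g_h[of y] chart_inv_d[of "f (t (h y))"] by (simp add: B_def g_def)

text \<open>The inverse of the homeomorphism \<open>snd d\<close> is only given abstractly; it agrees with
  \<open>chart_inv d\<close> on \<open>A\<close>.\<close>

lemma continuous_h: "continuous_on A h"
proof -
  obtain k where k: "homeomorphic_maps (subtopology (mtop Q) (fst d)) (top_of_set A) (snd d) k"
    using is_chart unfolding is_chart_def homeomorphic_map_maps A_def by blast
  have "continuous_map (subtopology (mtop Q) (fst d)) (top_of_set W) s0"
    using homeomorphic_maps_s0 continuous_map_from_subtopology by (auto simp: homeomorphic_maps_def)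
  then have "continuous_map (top_of_set A) (top_of_set W) (s0 \<circ> k)"
    using k continuous_map_compose unfolding homeomorphic_maps_def by blast
  then have "continuous_on A (s0 \<circ> k)" by simp
  moreover have "s0 (k y) = h y" if y: "y \<in> A" for y
  proof -
    obtain q where "q \<in> fst d" "y = snd d q" using y by (auto simp: A_def)
    then have "k y = q" using k topspace_chart by (simp add: homeomorphic_maps_def)
    then show ?thesis using \<open>q \<in> fst d\<close> \<open>y = snd d q\<close> by (simp add: h_def chart_inv_d)
  qed
  ultimately show ?thesis by (simp cong: continuous_on_cong)
qed

lemma local_dom_R: "local_dom id_chart d f = R"
  by (simp add: local_dom_def R_def)

lemma local_rep_R: "x \<in> R \<Longrightarrow> local_rep id_chart d f x = snd d (f x)"
  by (simp add: local_rep_def R_def chart_inv_id)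

lemma smooth_d_f: "smooth_on R (local_rep id_chart d f)"
  using chart by (simp add: quotient_chart_def local_dom_R)

lemma smooth_g: "smooth_on B g"
proof -
  have "smooth_on B (\<lambda>w. local_rep id_chart d f (t w))"
    using t_R lin_t
    by (intro smooth_on_compose[OF open_B open_R _ _ smooth_d_f])
      (auto simp: smooth_on_def Ck_on_bounded_linear open_B)
  then show ?thesis
    using smooth_on_cong[OF open_B, of "\<lambda>w. local_rep id_chart d f (t w)" g]
    by (simp add: local_rep_R t_R g_def)
qed

lemma der_g: "w \<in> B \<Longrightarrow> (g has_derivative Dg w) (at w)"
  using smooth_on_has_derivative[OF smooth_g] by (simp add: Dg_def)

lemma der_d_f: "x \<in> R \<Longrightarrow> (local_rep id_chart d f has_derivative (\<lambda>X. Dg (s x) (ds x X))) (at x)"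
proof -
  assume x: "x \<in> R"
  then have xS: "x \<in> S" by (simp add: R_def)
  have "((\<lambda>x. g (s x)) has_derivative (\<lambda>X. Dg (s x) (ds x X))) (at x)"
    using diff_chain_at[OF der_ds[OF xS] der_g[OF s_B[OF x]]] by (simp add: o_def)
  then show ?thesis
    by (rule has_derivative_transform_within_open[OF _ open_R x]) (simp add: g_s local_rep_R)
qed

lemma differential_d: "x \<in> R \<Longrightarrow> differential id_chart d f x = (\<lambda>X. Dg (s x) (ds x X))"
  using frechet_derivative_at[OF der_d_f] by (simp add: differential_def)

lemma linear_Dg: "w \<in> B \<Longrightarrow> linear (Dg w)"
  using der_g has_derivative_linear by blast

text \<open>A surjective endomorphism of a space of finite dimension is injective.\<close>

lemma inj_Dg: "w \<in> B \<Longrightarrow> inj (Dg w)"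
proof -
  assume w: "w \<in> B"
  have "surj (differential id_chart d f (t w))"
    using chart t_R[OF w] by (simp add: quotient_chart_def R_def)
  then have "surj (Dg w)"
    using s_t[OF B_sub[OF w]] by (auto simp: differential_d[OF t_R[OF w]] surj_def)
  then show ?thesis using linear_Dg[OF w] linear_surjective_imp_injective by blast
qed

lemma smooth_h: "smooth_on A h"
  using inj_Dg h_B
  by (intro smooth_on_inverse_map[OF open_A open_B continuous_h _ g_h smooth_g]) (auto simp: Dg_def)

lemma der_h: "y \<in> A \<Longrightarrow> (h has_derivative Dh y) (at y)"
  using smooth_on_has_derivative[OF smooth_h] by (simp add: Dh_def)

lemma Dh_Dg: "w \<in> B \<Longrightarrow> Dh (g w) (Dg w u) = u"
proof -
  assume w: "w \<in> B"
  have "((\<lambda>w. h (g w)) has_derivative (\<lambda>u. Dh (g w) (Dg w u))) (at w)"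
    using diff_chain_at[OF der_g[OF w] der_h[OF g_A[OF w]]] by (simp add: o_def)
  then have "((\<lambda>w. w) has_derivative (\<lambda>u. Dh (g w) (Dg w u))) (at w)"
    by (rule has_derivative_transform_within_open[OF _ open_B w]) (simp add: h_g)
  then show ?thesis using has_derivative_unique[OF _ has_derivative_ident] by metis
qed

lemma Dg_Dh: "y \<in> A \<Longrightarrow> Dg (h y) (Dh y u) = u"
proof -
  assume y: "y \<in> A"
  have "surj (Dg (h y))"
    using inj_Dg linear_Dg h_B[OF y] linear_injective_imp_surjective by blast
  then show ?thesis using Dh_Dg[OF h_B[OF y]] g_h[OF y] by (metis surjD)
qed

text \<open>The kernel of the differential of the projection does not depend on the chart.\<close>

lemma horizontal_d:
  "x \<in> R \<Longrightarrow> horizontal N id_chart d f x u \<longleftrightarrow> (\<forall>w. ds x w = 0 \<longrightarrow> u \<bullet> w = 0)"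
  using inj_Dg[OF s_B] linear_Dg[OF s_B]
  by (simp add: horizontal_def differential_d) (metis linear_0 injD)

text \<open>The quotient metric is Euclidean after passing to the coordinates \<open>s\<close>, since horizontal
  vectors have the same inner products as their images under \<open>ds\<close>. The description of the metric
  determines this value because every tangent vector of the quotient has a horizontal lift.\<close>

lemma metric_d:
  assumes "q \<in> fst d"
  shows "metric Q d q u v = Dh (snd d q) u \<bullet> Dh (snd d q) v"
proof -
  let ?Pr = "\<lambda>r. \<forall>c\<in>atlas N. \<forall>p\<in>fst c. \<forall>u' v'.
        f p = q \<and> horizontal N c d f p u' \<and> differential c d f p u' = u \<and>
        horizontal N c d f p v' \<and> differential c d f p v' = v \<longrightarrow> metric N c p u' v' = r"
  let ?r = "Dh (snd d q) u \<bullet> Dh (snd d q) v"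
  obtain x where "x \<in> S" "q = f x" using assms fst_d by auto
  then have x: "x \<in> R" using assms by (simp add: R_def)
  have "?Pr ?r"
  proof (clarsimp)
    fix p u' v' assume p: "p \<in> S" "q = f p" and hor: "horizontal N id_chart d f p u'"
      and uv: "u = differential id_chart d f p u'" "v = differential id_chart d f p v'"
    then have pO: "p \<in> R" using assms by (simp add: R_def)
    have "snd d (f p) = g (s p)" using g_s[OF pO] by simp
    then have "Dh (snd d (f p)) (differential id_chart d f p w) = ds p w" for w
      using Dh_Dg[OF s_B[OF pO]] by (simp add: differential_d[OF pO])
    then show "u' \<bullet> v' = Dh (snd d (f p)) (differential id_chart d f p u')
        \<bullet> Dh (snd d (f p)) (differential id_chart d f p v')"
      using horizontal_isometry[OF p(1)] hor by (simp add: horizontal_d[OF pO])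
  qed
  moreover have "r = ?r" if r: "?Pr r" for r
  proof -
    have "horizontal N id_chart d f x (lift x w)" for w
      by (simp add: horizontal_d[OF x] lift_inner)
    moreover have "differential id_chart d f x (lift x (Dh (snd d q) w)) = w" for w
    proof -
      have "snd d q \<in> A" "h (snd d q) = s x"
        using assms h_g[OF s_B[OF x]] g_s[OF x] \<open>q = f x\<close> by (auto simp: A_def)
      then show ?thesis using Dg_Dh[of "snd d q" w] ds_lift[OF \<open>x \<in> S\<close>] by (simp add: differential_d[OF x])
    qed
    ultimately have "lift x (Dh (snd d q) u) \<bullet> lift x (Dh (snd d q) v) = r"
      using r \<open>x \<in> S\<close> \<open>q = f x\<close> by simp
    then show ?thesis by (simp add: lift_inner ds_lift[OF \<open>x \<in> S\<close>])
  qed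
  ultimately have "(THE r. ?Pr r) = ?r" by (rule the_equality)
  then show ?thesis by (simp only: Q_simps quotient_metric_def)
qed

end

context submersion_with_section
begin

lemma chart_of_quotient: "d \<in> atlas Q \<Longrightarrow> chart_of_quotient S f s W t P d"
  by unfold_locales (simp add: Q_simps)

text \<open>The transition from \<open>d\<close> to \<open>e\<close> goes through the chart \<open>s0\<close>. The last claim is the smooth
  compatibility of the two charts, the others are what computing the derivative requires.\<close>

lemma transition:
  assumes "d \<in> atlas Q" "e \<in> atlas Q"
  defines "y_dom \<equiv> local_dom d e id"
  shows "open y_dom" "y_dom \<subseteq> snd d ` fst d"
    "\<And>y. y \<in> y_dom \<Longrightarrow> chart_of_quotient.h f W t d y \<in> chart_of_quotient.B f W t e"
    "\<And>y. y \<in> y_dom \<Longrightarrow> local_rep d e id y = chart_of_quotient.g f t e (chart_of_quotient.h f W t d y)"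
    "smooth_on y_dom (local_rep d e id)"
proof -
  interpret d: chart_of_quotient S f s W t P d by (rule chart_of_quotient) fact
  interpret e: chart_of_quotient S f s W t P e by (rule chart_of_quotient) fact
  have h: "y \<in> y_dom \<longleftrightarrow> y \<in> d.A \<inter> d.h -` e.B" for y
  proof
    assume "y \<in> y_dom"
    then obtain q where q: "q \<in> fst d" "q \<in> fst e" "y = snd d q"
      by (auto simp: y_dom_def local_dom_def)
    then have "y \<in> d.A" by (auto simp: d.A_def)
    moreover have "f (t (d.h y)) = q" using d.chart_inv_h[OF \<open>y \<in> d.A\<close>] q d.chart_inv_d by simp
    ultimately show "y \<in> d.A \<inter> d.h -` e.B"
      using q d.B_sub[OF d.h_B] by (simp add: e.B_def)
  next
    assume y: "y \<in> d.A \<inter> d.h -` e.B"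
    then have "f (t (d.h y)) \<in> fst e" "f (t (d.h y)) \<in> fst d" "y = snd d (f (t (d.h y)))"
      using d.h_B[of y] d.g_h[of y] by (auto simp: e.B_def d.B_def d.g_def)
    then show "y \<in> y_dom" by (auto simp: y_dom_def local_dom_def)
  qed
  then show sub: "y_dom \<subseteq> snd d ` fst d" by (auto simp: d.A_def)
  show o: "open y_dom"
    using h continuous_open_preimage[OF d.continuous_h d.open_A e.open_B] by (metis subsetI subset_antisym)
  show hB: "\<And>y. y \<in> y_dom \<Longrightarrow> d.h y \<in> e.B" using h by auto
  show rep: "\<And>y. y \<in> y_dom \<Longrightarrow> local_rep d e id y = e.g (d.h y)"
    using h by (simp add: local_rep_def d.chart_inv_h e.g_def)
  have "smooth_on y_dom (\<lambda>y. e.g (d.h y))"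
    using h by (intro smooth_on_compose[OF o e.open_B _ _ e.smooth_g] smooth_on_subset[OF d.smooth_h]) auto
  then show "smooth_on y_dom (local_rep d e id)"
    using smooth_on_cong[OF o rep] by simp
qed

lemma smooth_manifold_Q: "smooth_manifold Q"
proof -
  have "mtop Q homeomorphic_space top_of_set W"
    using homeomorphic_maps_s0 homeomorphic_space_def by blast
  then have "Hausdorff_space (mtop Q)" "second_countable (mtop Q)"
    using homeomorphic_Hausdorff_space homeomorphic_space_second_countability
      Hausdorff_space_subtopology[OF Hausdorff_space_euclidean] second_countable_subtopology
      second_countable_UNIV by blast+
  moreover have "is_chart (mtop Q) d" if "d \<in> atlas Q" for d
    using chart_of_quotient.is_chart[OF chart_of_quotient[OF that]] .
  moreover have "(\<Union>c\<in>atlas Q. fst c) = topspace (mtop Q)"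
  proof
    show "(\<Union>c\<in>atlas Q. fst c) \<subseteq> topspace (mtop Q)"
      using chart_of_quotient.fst_d[OF chart_of_quotient] topspace_Q by blast
    show "topspace (mtop Q) \<subseteq> (\<Union>c\<in>atlas Q. fst c)"
    proof -
      have "(f ` S, s0) \<in> atlas Q" using chart_s0 by (simp add: Q_simps)
      then show ?thesis unfolding topspace_Q by force
    qed
  qed
  ultimately show ?thesis using transition(5) by (simp add: smooth_manifold_def)
qed

text \<open>In the chart \<open>d\<close> the metric is the pullback of the Euclidean one along \<open>h\<close>. Invariance under a
  change of charts is the chain rule for the transition map.\<close>

lemma riemannian_metric_Q: "riemannian_metric Q"
  unfolding riemannian_metric_def
proof (intro ballI conjI)
  fix d assume d: "d \<in> atlas Q"
  interpret d: chart_of_quotient S f s W t P d by (rule chart_of_quotient) fact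
  show "\<forall>u v. smooth_on (snd d ` fst d) (\<lambda>x. metric Q d (chart_inv d x) u v)"
  proof (intro allI)
    fix u v
    have "smooth_on d.A (\<lambda>x. d.Dh x u \<bullet> d.Dh x v)"
      using smooth_on_frechet_derivative[OF d.smooth_h]
      by (simp add: smooth_on_def Ck_on_bilinear[OF bounded_bilinear_inner d.open_A] d.Dh_def)
    moreover have "metric Q d (chart_inv d x) u v = d.Dh x u \<bullet> d.Dh x v" if "x \<in> d.A" for x
      using that d.chart_inv_d d.metric_d by (auto simp: d.A_def)
    ultimately show "smooth_on (snd d ` fst d) (\<lambda>x. metric Q d (chart_inv d x) u v)"
      using smooth_on_cong[OF d.open_A, of "\<lambda>x. metric Q d (chart_inv d x) u v" "\<lambda>x. d.Dh x u \<bullet> d.Dh x v"]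
      by (simp add: d.A_def)
  qed
  fix q assume q: "q \<in> fst d"
  then have A: "snd d q \<in> d.A" by (simp add: d.A_def)
  then have lin: "linear (d.Dh (snd d q))" using d.der_h has_derivative_linear by blast
  show "bilinear (metric Q d q)"
    using lin by (simp add: d.metric_d[OF q] bilinear_def linear_iff inner_add_left inner_add_right)
  show "\<forall>u v. metric Q d q u v = metric Q d q v u"
    by (simp add: d.metric_d[OF q] inner_commute)
  show "\<forall>u. u \<noteq> 0 \<longrightarrow> metric Q d q u u > 0"
  proof (intro allI impI)
    fix u :: "real^'m" assume "u \<noteq> 0"
    moreover have "d.Dg (d.h (snd d q)) 0 = 0"
      using d.linear_Dg[OF d.h_B[OF A]] linear_0 by blast
    ultimately have "d.Dh (snd d q) u \<noteq> 0" using d.Dg_Dh[OF A, of u] by auto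
    then show "metric Q d q u u > 0" by (simp add: d.metric_d[OF q])
  qed
next
  fix d e q assume d: "d \<in> atlas Q" and e: "e \<in> atlas Q" and q: "q \<in> fst d \<inter> fst e"
  interpret d: chart_of_quotient S f s W t P d by (rule chart_of_quotient) fact
  interpret e: chart_of_quotient S f s W t P e by (rule chart_of_quotient) fact
  let ?y = "snd d q"
  note tr = transition[OF d e]
  have y: "?y \<in> local_dom d e id" "?y \<in> d.A" using q by (auto simp: local_dom_def d.A_def)
  have "((\<lambda>y. e.g (d.h y)) has_derivative (\<lambda>u. e.Dg (d.h ?y) (d.Dh ?y u))) (at ?y)"
    using diff_chain_at[OF d.der_h[OF y(2)] e.der_g[OF tr(3)[OF y(1)]]] by (simp add: o_def)
  then have "(local_rep d e id has_derivative (\<lambda>u. e.Dg (d.h ?y) (d.Dh ?y u))) (at ?y)"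
    by (rule has_derivative_transform_within_open[OF _ tr(1) y(1)]) (simp add: tr(4))
  then have D: "differential d e id q u = e.Dg (d.h ?y) (d.Dh ?y u)" for u
    by (simp add: differential_def frechet_derivative_at[symmetric])
  have "e.g (d.h ?y) = snd e q"
    using tr(4)[OF y(1)] q d.chart_inv_d by (simp add: local_rep_def)
  then have "e.Dh (snd e q) (differential d e id q u) = d.Dh ?y u" for u
    using e.Dh_Dg[OF tr(3)[OF y(1)]] by (simp add: D)
  then show "\<forall>u v. metric Q d q u v = metric Q e q (differential d e id q u) (differential d e id q v)"
    using q by (simp add: d.metric_d e.metric_d)
qed

theorem riemannian_submersion_quotient: "riemannian_submersion N Q f"
proof -
  have "riemannian_manifold Q"
    by (simp add: riemannian_manifold_def smooth_manifold_Q riemannian_metric_Q)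
  moreover have "continuous_map (mtop N) (mtop Q) f"
    unfolding Q_simps N_simps by (rule quotient_imp_continuous_map[OF quotient_map_quotient_topology])
  then have "smooth_map N Q f"
    by (simp add: smooth_map_def Q_simps quotient_chart_def)
  moreover have "surj (differential id_chart d f p)" if "d \<in> atlas Q" "p \<in> S" "f p \<in> fst d" for d p
    using that by (simp add: Q_simps quotient_chart_def)
  moreover have "metric Q d (f p) (differential id_chart d f p u) (differential id_chart d f p v) = u \<bullet> v"
    if "d \<in> atlas Q" "p \<in> S" "f p \<in> fst d" "horizontal N id_chart d f p u" for d p u v
  proof -
    interpret d: chart_of_quotient S f s W t P d by (rule chart_of_quotient) fact
    have p: "p \<in> d.R" using that by (simp add: d.R_def)
    have "snd d (f p) = d.g (s p)" using d.g_s[OF p] by simp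
    then have "d.Dh (snd d (f p)) (differential id_chart d f p w) = ds p w" for w
      using d.Dh_Dg[OF d.s_B[OF p]] by (simp add: d.differential_d[OF p])
    then show ?thesis
      using horizontal_isometry[OF that(2)] that(3,4) by (simp add: d.horizontal_d[OF p] d.metric_d)
  qed
  ultimately show ?thesis
    using riemannian_manifold_N by (simp add: riemannian_submersion_def)
qed

theorem euclidean_global_chart_quotient: "euclidean_global_chart Q W (f \<circ> t)"
proof -
  let ?d = "(f ` S, s0)"
  have d: "?d \<in> atlas Q" using chart_s0 by (simp add: Q_simps)
  interpret d: chart_of_quotient S f s W t P ?d by (rule chart_of_quotient) fact
  have "bij_betw (f \<circ> t) W (topspace (mtop Q))"
    using inj_on_f_t f_t_image unfolding bij_betw_def topspace_Q by blast
  moreover have "metric Q ?d q u v = u \<bullet> v" if "q \<in> f ` S" for q u v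
  proof -
    have A: "snd ?d q \<in> d.A" using that by (auto simp: d.A_def)
    have "d.h y = y" if "y \<in> d.A" for y
      using d.h_B[OF that] d.g_h[OF that] by (auto simp: d.g_def d.B_def s0_f t_S s_t)
    then have "(d.h has_derivative (\<lambda>u. u)) (at (snd ?d q))"
      by (intro has_derivative_transform_within_open[OF has_derivative_ident d.open_A A]) simp
    then have "d.Dh (snd ?d q) = (\<lambda>u. u)"
      by (simp add: d.Dh_def frechet_derivative_at[symmetric])
    then show ?thesis using d.metric_d that by simp
  qed
  ultimately show ?thesis
    using d by (simp add: euclidean_global_chart_def topspace_Q s0_def)
qed

end

section \<open>Conjugation and the inner product of matrices\<close>

lemma star_1 [simp]: "star (1 :: 'f::star_algebra) = 1"
  using star_mult[of "star 1" "1 :: 'f"] by (simp add: star_star)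

lemma real_part_eq_inner: "real_part x = inner x (1 :: 'f::star_algebra)"
  using inner_eq_real_part[of x 1] by simp

lemma inner_1_1: "inner (1 :: 'f::star_algebra) 1 = 1"
  by (simp flip: power2_norm_eq_inner)

text \<open>The class axioms determine conjugation as the reflection in the line of real multiples
  of \<open>1\<close>; in particular it is real-linear and an isometry.\<close>

lemma star_eq: "star x = (2 * inner x 1) *\<^sub>R 1 - (x :: 'f::star_algebra)"
  using add_star[of x] by (simp add: real_part_eq_inner algebra_simps)

lemma linear_star: "linear (star :: 'f::star_algebra \<Rightarrow> 'f)"
  by (rule linearI) (simp_all add: star_eq inner_add_left algebra_simps)

lemmas star_linear_simps [simp] = linear_0[OF linear_star] linear_scale[OF linear_star]
  linear_sum[OF linear_star]

lemma star_of_real [simp]: "star (of_real r) = (of_real r :: 'f::star_algebra)"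
  by (simp add: of_real_def)

lemma inner_star_star: "inner (star x) (star y) = inner x (y :: 'f::star_algebra)"
  by (simp add: star_eq inner_diff_left inner_diff_right inner_1_1 inner_commute)

text \<open>The substitute for commutativity: real parts of products, and hence real traces, are cyclic.
  It makes left and right multiplication adjoint to those by the conjugate.\<close>

lemma real_part_commute: "real_part (x * y) = real_part (y * (x :: 'f::star_algebra))"
proof -
  have "real_part (x * y) = inner x (star y)" by (simp add: inner_eq_real_part star_star)
  also have "\<dots> = inner y (star x)" using inner_star_star[of "star y" x] by (simp add: star_star inner_commute)
  also have "\<dots> = real_part (y * x)" by (simp add: inner_eq_real_part star_star)
  finally show ?thesis .
qed

lemma inner_mult_left: "inner (a * x) y = inner x (star a * (y :: 'f::star_algebra))"
  using real_part_commute[of a "x * star y"] by (simp add: inner_eq_real_part star_mult star_star mult.assoc)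

lemma inner_mult_right: "inner (x * a) y = inner x (y * star (a :: 'f::star_algebra))"
  by (simp add: inner_eq_real_part star_mult star_star mult.assoc)

text \<open>An element equal to its conjugate is a real multiple of \<open>1\<close>.\<close>

lemma star_mult_self: "star x * x = of_real (inner x (x :: 'f::star_algebra))"
proof -
  have "star x * x + star (star x * x) = (2 * real_part (star x * x)) *\<^sub>R 1" by (rule add_star)
  then have "2 *\<^sub>R (star x * x) = 2 *\<^sub>R of_real (real_part (star x * x))"
    by (simp add: star_mult star_star of_real_def scaleR_2[of "star x * x"])
  moreover have "real_part (star x * x) = inner x x"
    by (metis inner_eq_real_part real_part_commute)
  ultimately show ?thesis by simp
qed

section \<open>Matrices over a noncommutative algebra\<close>

lemma conj_transpose_nth [simp]: "conj_transpose A $ i $ j = star (A $ j $ i)"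
  by (simp add: conj_transpose_def)

lemma matrix_mult_nth: "(A ** B) $ i $ j = (\<Sum>k\<in>UNIV. A $ i $ k * B $ k $ j)"
  by (simp add: matrix_matrix_mult_def)

lemma matrix_vector_nth: "(A *v x) $ i = (\<Sum>k\<in>UNIV. A $ i $ k * x $ k)"
  by (simp add: matrix_vector_mult_def)

lemma conj_transpose_mult:
  "conj_transpose (A ** B) = conj_transpose B ** conj_transpose (A :: 'f::star_algebra^'k^'n)"
  by (simp add: vec_eq_iff matrix_mult_nth star_mult)

lemma conj_transpose_twice [simp]: "conj_transpose (conj_transpose A) = A"
  by (simp add: vec_eq_iff star_star)

lemma conj_transpose_mat_1 [simp]: "conj_transpose (mat 1) = mat 1"
  by (simp add: vec_eq_iff mat_def)

lemma bounded_linear_conj_transpose: "bounded_linear (conj_transpose :: 'f::star_algebra^'m^'n \<Rightarrow> _)"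
  unfolding linear_conv_bounded_linear[symmetric]
  by (rule linearI) (simp_all add: vec_eq_iff star_add)

lemma bounded_bilinear_matrix_mult:
  "bounded_bilinear ((**) :: 'f::star_algebra^'k^'n \<Rightarrow> 'f^'m^'k \<Rightarrow> 'f^'m^'n)"
  unfolding bilinear_conv_bounded_bilinear[symmetric] bilinear_def
  by (intro conjI allI linearI)
    (simp_all add: vec_eq_iff matrix_mult_nth algebra_simps sum.distrib scaleR_sum_right)

lemma bounded_bilinear_matrix_vector_mult:
  "bounded_bilinear ((*v) :: 'f::star_algebra^'k^'n \<Rightarrow> 'f^'k \<Rightarrow> 'f^'n)"
  unfolding bilinear_conv_bounded_bilinear[symmetric] bilinear_def
  by (intro conjI allI linearI)
    (simp_all add: vec_eq_iff matrix_vector_nth algebra_simps sum.distrib scaleR_sum_right)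

lemmas matrix_mult_simps = bounded_bilinear.scaleR_left[OF bounded_bilinear_matrix_mult]
  bounded_bilinear.scaleR_right[OF bounded_bilinear_matrix_mult]
  bounded_bilinear.diff_left[OF bounded_bilinear_matrix_mult]
  bounded_bilinear.diff_right[OF bounded_bilinear_matrix_mult]

lemmas matrix_vector_simps = bounded_bilinear.scaleR_right[OF bounded_bilinear_matrix_vector_mult]
  bounded_bilinear.diff_right[OF bounded_bilinear_matrix_vector_mult]
  bounded_bilinear.zero_right[OF bounded_bilinear_matrix_vector_mult]

lemma linear_matrix_vector_mult: "linear ((*v) (A :: 'f::star_algebra^'k^'n))"
  using bounded_bilinear.bounded_linear_right[OF bounded_bilinear_matrix_vector_mult]
  by (simp add: linear_conv_bounded_linear)

lemma frobenius_eq_inner: "frobenius = inner"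
  by (simp add: fun_eq_iff frobenius_def trace_def matrix_mult_nth real_part_eq_inner inner_sum_left
      inner_vec_def inner_mult_right star_star)

lemma inner_matrix_mult_left:
  fixes A :: "'f::star_algebra^'k^'n" and X :: "'f^'m^'k"
  shows "inner (A ** X) Y = inner X (conj_transpose A ** Y)"
proof -
  have "inner (A ** X) Y = (\<Sum>i\<in>UNIV. \<Sum>j\<in>UNIV. \<Sum>k\<in>UNIV. inner (X $ k $ j) (star (A $ i $ k) * Y $ i $ j))"
    by (simp add: inner_vec_def matrix_mult_nth inner_sum_left inner_mult_left)
  also have "\<dots> = (\<Sum>i\<in>UNIV. \<Sum>k\<in>UNIV. \<Sum>j\<in>UNIV. inner (X $ k $ j) (star (A $ i $ k) * Y $ i $ j))"
    by (intro sum.cong refl sum.swap)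
  also have "\<dots> = (\<Sum>k\<in>UNIV. \<Sum>i\<in>UNIV. \<Sum>j\<in>UNIV. inner (X $ k $ j) (star (A $ i $ k) * Y $ i $ j))"
    by (rule sum.swap)
  also have "\<dots> = (\<Sum>k\<in>UNIV. \<Sum>j\<in>UNIV. \<Sum>i\<in>UNIV. inner (X $ k $ j) (star (A $ i $ k) * Y $ i $ j))"
    by (intro sum.cong refl sum.swap)
  also have "\<dots> = inner X (conj_transpose A ** Y)"
    by (simp add: inner_vec_def matrix_mult_nth inner_sum_right)
  finally show ?thesis .
qed

lemma inner_conj_transpose:
  "inner (conj_transpose A) (conj_transpose B) = inner A (B :: 'f::star_algebra^'k^'n)"
  by (simp add: inner_vec_def inner_star_star) (rule sum.swap)

lemma inner_matrix_mult_right: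
  fixes A :: "'f::star_algebra^'m^'k" and X :: "'f^'k^'n"
  shows "inner (X ** A) Y = inner X (Y ** conj_transpose A)"
proof -
  have "inner (X ** A) Y = inner (conj_transpose A ** conj_transpose X) (conj_transpose Y)"
    using inner_conj_transpose[of "X ** A" Y] by (simp add: conj_transpose_mult)
  also have "\<dots> = inner (conj_transpose X) (conj_transpose (Y ** conj_transpose A))"
    by (simp add: inner_matrix_mult_left conj_transpose_mult)
  finally show ?thesis by (simp add: inner_conj_transpose)
qed

lemma inner_matrix_vector_mult:
  fixes A :: "'f::star_algebra^'k^'n"
  shows "inner (A *v x) y = inner x (conj_transpose A *v y)"
proof -
  have "inner (A *v x) y = (\<Sum>i\<in>UNIV. \<Sum>k\<in>UNIV. inner (x $ k) (star (A $ i $ k) * y $ i))"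
    by (simp add: inner_vec_def matrix_vector_nth inner_sum_left inner_mult_left)
  also have "\<dots> = (\<Sum>k\<in>UNIV. \<Sum>i\<in>UNIV. inner (x $ k) (star (A $ i $ k) * y $ i))"
    by (rule sum.swap)
  finally show ?thesis by (simp add: inner_vec_def matrix_vector_nth inner_sum_right)
qed

section \<open>Unitary matrices\<close>

text \<open>Determinants need commutative entries. Instead, columns form a real vector
  space of finite dimension, where an injective endomorphism is surjective.\<close>

lemma matrix_mult_1_commute:
  fixes A B :: "'f::star_algebra^'k^'k"
  assumes "A ** B = mat 1"
  shows "B ** A = mat 1"
proof -
  have "A *v (B *v x) = x" for x
    using assms by (simp add: matrix_vector_mul_assoc)
  moreover from this have "surj ((*v) B)"
    using linear_injective_imp_surjective[OF linear_matrix_vector_mult, of B] by (metis injI)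
  ultimately have "(B ** A) *v y = mat 1 *v y" for y
    by (metis matrix_vector_mul_assoc matrix_vector_mul_lid surjD)
  then show ?thesis by (simp add: matrix_eq)
qed

lemma unitaryD:
  assumes "U \<in> unitary"
  shows "U ** conj_transpose U = mat 1" "conj_transpose U ** U = mat 1"
  using assms matrix_mult_1_commute by (auto simp: unitary_def)

lemma unitaryI: "conj_transpose U ** U = mat 1 \<Longrightarrow> U \<in> unitary"
  using matrix_mult_1_commute by (auto simp: unitary_def)

lemma unitary_cancel:
  fixes U :: "'f::star_algebra^'k^'k" and X :: "'f^'m^'k" and Y :: "'f^'k^'n"
  assumes "U \<in> unitary"
  shows "conj_transpose U ** (U ** X) = X" "U ** (conj_transpose U ** X) = X"
    "Y ** U ** conj_transpose U = Y" "Y ** conj_transpose U ** U = Y"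
proof -
  show "conj_transpose U ** (U ** X) = X" "U ** (conj_transpose U ** X) = X"
    by (simp_all add: matrix_mul_assoc unitaryD[OF assms])
  show "Y ** U ** conj_transpose U = Y" "Y ** conj_transpose U ** U = Y"
    by (simp_all add: unitaryD[OF assms] flip: matrix_mul_assoc)
qed

lemma unitary_mat_1: "mat 1 \<in> unitary"
  by (simp add: unitary_def)

lemma unitary_mult:
  assumes "U \<in> unitary" "V \<in> unitary"
  shows "U ** V \<in> unitary"
  using assms
  by (intro unitaryI) (simp add: conj_transpose_mult unitaryD unitary_cancel flip: matrix_mul_assoc)

lemma unitary_conj_transpose: "U \<in> unitary \<Longrightarrow> conj_transpose U \<in> unitary"
  using unitaryD by (intro unitaryI) simp

lemma inner_unitary:
  assumes "U \<in> unitary" "V \<in> unitary"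
  shows "inner (U ** X ** conj_transpose V) (U ** Y ** conj_transpose V) = inner X Y"
proof -
  have "inner (U ** (X ** conj_transpose V)) (U ** (Y ** conj_transpose V))
      = inner (X ** conj_transpose V) (Y ** conj_transpose V)"
    by (simp only: inner_matrix_mult_left[of U] unitary_cancel[OF assms(1)])
  also have "\<dots> = inner X Y"
    by (simp only: inner_matrix_mult_right[of X] conj_transpose_twice unitary_cancel[OF assms(2)])
  finally show ?thesis by (simp only: matrix_mul_assoc)
qed

text \<open>The real inner product of columns is only the real part of this Hermitian product. Unitarity is
  orthonormality in the Hermitian sense, which is stronger.\<close>

definition hprod :: "'f::star_algebra^'n \<Rightarrow> 'f^'n \<Rightarrow> 'f" where
  "hprod x y = (\<Sum>a\<in>UNIV. star (x $ a) * y $ a)"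

lemma star_hprod: "star (hprod x y) = hprod y x"
  by (simp add: hprod_def star_mult star_star)

lemma hprod_self: "hprod x x = of_real (inner x x)"
  by (simp add: hprod_def star_mult_self inner_vec_def)

lemma linear_hprod: "linear (hprod x)"
  by (rule linearI) (simp_all add: hprod_def algebra_simps sum.distrib scaleR_sum_right)

lemma hprod_scaleR [simp]: "hprod (c *\<^sub>R x) y = c *\<^sub>R hprod x y" "hprod x (c *\<^sub>R y) = c *\<^sub>R hprod x y"
  by (simp_all add: hprod_def scaleR_sum_right)

lemma hprod_matrix_vector_mult:
  fixes A :: "'f::star_algebra^'k^'n"
  shows "hprod (A *v x) y = hprod x (conj_transpose A *v y)"
proof -
  have "hprod (A *v x) y = (\<Sum>i\<in>UNIV. \<Sum>k\<in>UNIV. star (x $ k) * (star (A $ i $ k) * y $ i))"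
    by (simp add: hprod_def matrix_vector_nth star_mult sum_distrib_right mult.assoc)
  also have "\<dots> = (\<Sum>k\<in>UNIV. \<Sum>i\<in>UNIV. star (x $ k) * (star (A $ i $ k) * y $ i))"
    by (rule sum.swap)
  finally show ?thesis by (simp add: hprod_def matrix_vector_nth sum_distrib_left)
qed

lemma unitary_columns:
  assumes "\<And>i j. hprod (w i) (w j) = (if i = j then 1 else 0)"
  shows "(\<chi> a i. w i $ a) \<in> unitary"
  using assms by (intro unitaryI) (simp add: vec_eq_iff matrix_mult_nth mat_def hprod_def)

text \<open>As long as a family of orthonormal columns is indexed by a proper subset of the rows, some
  unit column is orthogonal to all of them: taking products with the family is a real-linear
  endomorphism that is not surjective, hence not injective.\<close>

lemma extend_orthonormal:
  fixes u :: "'n::finite \<Rightarrow> 'f::star_algebra^'n"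
  assumes "\<And>i j. i \<in> J \<Longrightarrow> j \<in> J \<Longrightarrow> hprod (u i) (u j) = (if i = j then 1 else 0)"
  shows "\<exists>w. (\<forall>i\<in>J. w i = u i) \<and> (\<forall>i j. hprod (w i) (w j) = (if i = j then 1 else 0))"
  using assms
proof (induction "card (- J)" arbitrary: J u)
  case 0
  then have "J = UNIV" by (simp add: card_eq_0_iff) blast
  then show ?case using "0.prems" by (intro exI[of _ u]) simp
next
  case (Suc c)
  then have "- J \<noteq> {}" by auto
  then obtain k where k: "k \<notin> J" by blast
  let ?L = "\<lambda>x. \<chi> i. if i \<in> J then hprod (u i) x else 0"
  have "linear ?L"
    by (rule linearI) (auto simp: vec_eq_iff linear_add[OF linear_hprod])
  moreover have "axis k 1 \<noteq> ?L x" for x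
    using k by (auto simp: vec_eq_iff axis_def intro!: exI[of _ k])
  then have "\<not> surj ?L" unfolding surj_def by blast
  ultimately obtain x where x: "?L x = 0" "x \<noteq> 0"
    using linear_injective_imp_surjective[of ?L] linear_injective_0[of ?L] by blast
  define y where "y = (1 / norm x) *\<^sub>R x"
  have orth: "hprod (u i) y = 0" if "i \<in> J" for i
    using x(1) that by (simp add: y_def vec_eq_iff) metis
  have unit: "hprod y y = 1"
    using x(2) by (simp add: y_def hprod_self flip: power2_norm_eq_inner)
  have "hprod y (u i) = 0" if "i \<in> J" for i
    using orth[OF that] star_hprod[of "u i" y] by simp
  then have "hprod ((u(k := y)) i) ((u(k := y)) j) = (if i = j then 1 else 0)"
    if "i \<in> insert k J" "j \<in> insert k J" for i j
    using that Suc.prems orth unit k by auto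
  moreover have "c = card (- insert k J)"
    using Suc.hyps(2) k by (simp add: Compl_insert)
  ultimately obtain w where "\<forall>i\<in>insert k J. w i = (u(k := y)) i"
      "\<forall>i j. hprod (w i) (w j) = (if i = j then 1 else 0)"
    using Suc.hyps(1)[of "insert k J" "u(k := y)"] by blast
  moreover from this(1) have "\<forall>i\<in>J. w i = u i" using k by auto
  ultimately show ?case by blast
qed

section \<open>Eigenvalues of self-adjoint maps\<close>

text \<open>At a zero \<open>v\<close> the nonnegative quadratic form of \<open>k\<close> is minimal, so its derivative there
  vanishes. Concretely, moving from \<open>v\<close> a little in the direction \<open>- k v\<close> would make the form
  negative if \<open>k v\<close> were nonzero.\<close>

lemma selfadjoint_psd_kernel:
  fixes k :: "'a::real_inner \<Rightarrow> 'a"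
  assumes lin: "linear k" and sym: "\<And>x y. inner (k x) y = inner x (k y)"
    and psd: "\<And>x. inner (k x) x \<ge> 0" and v: "inner (k v) v = 0"
  shows "k v = 0"
proof (rule ccontr)
  assume nz: "k v \<noteq> 0"
  define w where "w = k v"
  define a b where "a = inner w w" and "b = inner (k w) w"
  have "a > 0" using nz by (simp add: a_def w_def)
  have "b \<ge> 0" using psd by (simp add: b_def)
  have "inner (k (v - c *\<^sub>R w)) (v - c *\<^sub>R w) = - 2 * c * a + c\<^sup>2 * b" for c
  proof -
    have k: "k (v - c *\<^sub>R w) = w - c *\<^sub>R k w"
      by (simp add: linear_diff[OF lin] linear_scale[OF lin] w_def)
    have "inner w v = 0" "inner (k w) v = a"
      using v sym[of w v] by (simp_all add: w_def a_def)
    then show ?thesis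
      unfolding k by (simp add: inner_diff_left inner_diff_right a_def b_def power2_eq_square algebra_simps)
  qed
  then have *: "- 2 * c * a + c\<^sup>2 * b \<ge> 0" for c using psd by metis
  (* The quadratic polynomial in c is negative for 0 < c < 2 a / b; the summand 1 avoids b = 0. *)
  define c where "c = a / (b + 1)"
  have "c > 0" using \<open>a > 0\<close> \<open>b \<ge> 0\<close> by (simp add: c_def)
  have "c * b < 2 * a"
  proof -
    have "c * b \<le> c * (b + 1)" using \<open>c > 0\<close> by simp
    also have "\<dots> = a" using \<open>b \<ge> 0\<close> by (simp add: c_def)
    finally show ?thesis using \<open>a > 0\<close> by simp
  qed
  then have "c * (c * b) < c * (2 * a)" using \<open>c > 0\<close> by simp
  then show False using *[of c] by (simp add: power2_eq_square algebra_simps)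
qed

text \<open>
  With \<open>g = k - \<mu>\<close>, let \<open>d < e\<close> be the minimum of \<open>norm (g v)\<close> over unit vectors and \<open>v\<close> a minimizer.
  Then \<open>g\<^sup>2 - d\<^sup>2\<close> is positive semidefinite and its quadratic form vanishes at \<open>v\<close>, so
  \<open>(g - d)(g + d) v = 0\<close>. Thus \<open>v\<close> or \<open>(g + d) v\<close> is an eigenvector of \<open>k\<close>, for \<open>\<mu> - d\<close> or \<open>\<mu> + d\<close>.
\<close>

lemma eigenvalue_near:
  fixes k :: "'a::euclidean_space \<Rightarrow> 'a"
  assumes lin: "linear k" and sym: "\<And>x y. inner (k x) y = inner x (k y)"
    and u: "norm u = 1" "norm (k u - \<mu> *\<^sub>R u) < e"
  shows "\<exists>l v. v \<noteq> 0 \<and> k v = l *\<^sub>R v \<and> \<bar>l - \<mu>\<bar> < e"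
proof -
  define g where "g x = k x - \<mu> *\<^sub>R x" for x
  have ling: "linear g"
    by (rule linearI) (simp_all add: g_def linear_add[OF lin] linear_scale[OF lin] algebra_simps)
  have symg: "inner (g x) y = inner x (g y)" for x y
    by (simp add: g_def inner_diff_left inner_diff_right sym)
  have "bounded_linear g" using ling by (simp add: linear_conv_bounded_linear)
  then have "continuous_on (sphere 0 1) (\<lambda>x. norm (g x))"
    by (intro continuous_on_norm linear_continuous_on)
  moreover have "sphere (0::'a) 1 \<noteq> {}" using u(1) by (metis empty_iff mem_sphere_0)
  ultimately obtain v where v: "norm v = 1" and min: "\<And>x. norm x = 1 \<Longrightarrow> norm (g v) \<le> norm (g x)"
    using continuous_attains_inf[OF compact_sphere, of 0 1 "\<lambda>x. norm (g x)"] by auto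
  define d where "d = norm (g v)"
  have d: "d < e" "d \<ge> 0" using min[OF u(1)] u(2) by (auto simp: d_def g_def)
  define q where "q x = g (g x) - d\<^sup>2 *\<^sub>R x" for x
  have innerq: "inner (q x) x = (norm (g x))\<^sup>2 - d\<^sup>2 * (norm x)\<^sup>2" for x
    by (simp add: q_def inner_diff_left symg power2_norm_eq_inner)
  have "q v = 0"
  proof (rule selfadjoint_psd_kernel[where k = q])
    show "linear q"
      by (rule linearI)
        (simp_all add: q_def linear_add[OF ling] linear_scale[OF ling] algebra_simps)
    show "inner (q x) y = inner x (q y)" for x y
      by (simp add: q_def inner_diff_left inner_diff_right symg)
    show "inner (q x) x \<ge> 0" for x
    proof (cases "x = 0")
      case False
      then have "d \<le> norm (g ((1 / norm x) *\<^sub>R x))" unfolding d_def by (intro min) simp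
      also have "\<dots> = norm (g x) / norm x" by (simp add: linear_scale[OF ling])
      finally have "d * norm x \<le> norm (g x)" using False by (simp add: field_simps)
      then have "(d * norm x)\<^sup>2 \<le> (norm (g x))\<^sup>2" using d by (intro power_mono) auto
      then show ?thesis by (simp add: innerq power_mult_distrib)
    qed (simp add: innerq)
    show "inner (q v) v = 0" by (simp add: innerq v d_def)
  qed
  define w where "w = g v + d *\<^sub>R v"
  have "g w = d *\<^sub>R w"
    using \<open>q v = 0\<close>
    by (simp add: w_def q_def linear_add[OF ling] linear_scale[OF ling] power2_eq_square algebra_simps)
  then have kw: "k w = (\<mu> + d) *\<^sub>R w" by (simp add: g_def algebra_simps)
  show ?thesis
  proof (cases "w = 0")
    case True
    then have "k v = (\<mu> - d) *\<^sub>R v" by (simp add: w_def g_def algebra_simps)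
    moreover have "v \<noteq> 0" using v by auto
    ultimately show ?thesis using d by (intro exI[of _ "\<mu> - d"] exI[of _ v]) simp
  next
    case False
    then show ?thesis using d kw by (intro exI[of _ "\<mu> + d"] exI[of _ w]) simp
  qed
qed

section \<open>The Weyl chamber\<close>

lemma weyl_chamber_inj: "\<sigma> \<in> weyl_chamber \<Longrightarrow> \<sigma> $ i = \<sigma> $ j \<longleftrightarrow> i = j"
  unfolding weyl_chamber_def by (metis (mono_tags, lifting) less_irrefl linorder_neqE mem_Collect_eq)

lemma weyl_chamber_pos: "\<sigma> \<in> weyl_chamber \<Longrightarrow> \<sigma> $ i > 0"
  by (simp add: weyl_chamber_def)

lemma open_weyl_chamber: "open (weyl_chamber :: ((real, 'm::{finite,linorder}) vec) set)"
proof -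
  have "open {\<sigma> :: (real, 'm) vec. i < j \<longrightarrow> \<sigma> $ i > \<sigma> $ j}" for i j
    by (cases "i < j") (auto intro!: open_Collect_less continuous_intros)
  moreover have "open {\<sigma> :: (real, 'm) vec. \<sigma> $ i > 0}" for i
    by (intro open_Collect_less continuous_intros)
  moreover have eq: "(weyl_chamber :: ((real, 'm) vec) set)
      = (\<Inter>i. \<Inter>j. {\<sigma>. i < j \<longrightarrow> \<sigma> $ i > \<sigma> $ j}) \<inter> (\<Inter>i. {\<sigma>. \<sigma> $ i > 0})"
    by (auto simp: weyl_chamber_def)
  ultimately show ?thesis unfolding eq by (intro open_Int open_INT) auto
qed

text \<open>Counting smaller elements numbers a finite linear order monotonically. It is used for \<open>position\<close>
  and for sorting a set of singular values.\<close>

lemma bij_betw_card_less: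
  fixes A :: "'a::linorder set"
  assumes "finite A"
  defines "rk \<equiv> \<lambda>x. card {y \<in> A. y < x}"
  shows "bij_betw rk A {..<card A}" "\<And>x y. x \<in> A \<Longrightarrow> x < y \<Longrightarrow> rk x < rk y"
proof -
  show mono: "rk x < rk y" if "x \<in> A" "x < y" for x y
    unfolding rk_def using that assms(1) by (intro psubset_card_mono) auto
  then have "inj_on rk A" by (metis inj_onI linorder_neq_iff nat_neq_iff)
  moreover have "rk ` A \<subseteq> {..<card A}"
    unfolding rk_def using assms(1) by (auto intro!: psubset_card_mono)
  ultimately show "bij_betw rk A {..<card A}"
    by (simp add: bij_betw_def card_image card_subset_eq)
qed

lemma bij_betw_position: "bij_betw position (UNIV :: 'i::{finite,linorder} set) {..<CARD('i)}"
  using bij_betw_card_less(1)[of "UNIV :: 'i set"] by (simp add: position_def[abs_def] lessThan_def)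

lemma position_less: "i < j \<Longrightarrow> position i < position (j :: 'i::{finite,linorder})"
  using bij_betw_card_less(2)[of "UNIV :: 'i set" i j] by (simp add: position_def lessThan_def)

lemma weyl_chamber_exists:
  fixes A :: "real set"
  assumes "card A = CARD('m::{finite,linorder})" and pos: "\<And>x. x \<in> A \<Longrightarrow> x > 0"
  shows "\<exists>\<sigma> :: (real, 'm::{finite,linorder}) vec. \<sigma> \<in> weyl_chamber \<and> range (($) \<sigma>) = A"
proof -
  have fin: "finite A" using assms(1) by (metis card.infinite zero_less_card_finite less_numeral_extra(3))
  \<comment> \<open>Singular values decrease while positions increase, hence the negated set.\<close>
  define rk where "rk = (\<lambda>x. card {y \<in> uminus ` A. y < x})"
  have card: "card (uminus ` A) = CARD('m)" using assms(1) by (simp add: card_image)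
  have r: "bij_betw rk (uminus ` A) {..<CARD('m)}"
    "\<And>x y. x \<in> uminus ` A \<Longrightarrow> x < y \<Longrightarrow> rk x < rk y"
    using bij_betw_card_less[of "uminus ` A"] fin card by (simp_all add: rk_def)
  define h :: "'m \<Rightarrow> real" where "h = inv_into (uminus ` A) rk \<circ> position"
  have h: "bij_betw h (UNIV :: 'm set) (uminus ` A)"
    unfolding h_def using bij_betw_trans[OF bij_betw_position bij_betw_inv_into[OF r(1)]] .
  have rh: "rk (h i) = position i" for i :: 'm
    using r(1) bij_betw_position[where 'i='m] unfolding h_def
    by (metis UNIV_I bij_betw_apply bij_betw_inv_into_right comp_apply)
  have "h i < h j" if "i < j" for i j :: 'm
    using position_less[OF that] rh r(2)[of "h j" "h i"] h that
    by (metis UNIV_I bij_betw_apply less_asym linorder_neqE)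
  moreover have "- h i > 0" for i using bij_betw_apply[OF h, of i] pos by auto
  moreover have "range (\<lambda>i. - h i) = uminus ` uminus ` A"
    using bij_betw_imp_surj_on[OF h] by (simp only: image_image[of uminus h UNIV, symmetric])
  then have "range (\<lambda>i. - h i) = A" by (simp add: image_image)
  ultimately show ?thesis
    by (intro exI[of _ "\<chi> i. - h i"]) (auto simp: weyl_chamber_def)
qed

text \<open>The entry at \<open>i\<close> is the element of the range that has as many larger elements as \<open>i\<close> has
  smaller indices.\<close>

lemma weyl_chamber_unique:
  fixes \<sigma> \<tau> :: "(real, 'm::{finite,linorder}) vec"
  assumes "\<sigma> \<in> weyl_chamber" "\<tau> \<in> weyl_chamber" and range: "range (($) \<sigma>) = range (($) \<tau>)"
  shows "\<sigma> = \<tau>"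
proof -
  have card: "card {t \<in> range (($) \<rho>). t > \<rho> $ i} = card {..<i}"
    if "\<rho> \<in> weyl_chamber" for \<rho> :: "(real, 'm) vec" and i
  proof -
    have "\<rho> $ j > \<rho> $ i \<longleftrightarrow> j < i" for j
      using that by (cases i j rule: linorder_cases) (auto simp: weyl_chamber_def dest: less_asym)
    then have "{t \<in> range (($) \<rho>). t > \<rho> $ i} = ($) \<rho> ` {..<i}" by auto
    then show ?thesis using that by (simp add: card_image inj_on_def weyl_chamber_inj)
  qed
  have le: "\<rho> $ i \<ge> \<rho>' $ i" if "\<rho> \<in> weyl_chamber" "\<rho>' \<in> weyl_chamber" "range (($) \<rho>) = range (($) \<rho>')"
    for \<rho> \<rho>' :: "(real, 'm) vec" and i
  proof (rule ccontr)
    assume "\<not> \<rho> $ i \<ge> \<rho>' $ i"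
    then have "{t \<in> range (($) \<rho>). t > \<rho>' $ i} \<subset> {t \<in> range (($) \<rho>). t > \<rho> $ i}"
      using that(3) by auto
    then have "card {t \<in> range (($) \<rho>). t > \<rho>' $ i} < card {t \<in> range (($) \<rho>). t > \<rho> $ i}"
      by (intro psubset_card_mono) auto
    then show False using card[OF that(1), of i] card[OF that(2), of i] that(3) by simp
  qed
  show ?thesis using le[of \<sigma> \<tau>] le[of \<tau> \<sigma>] assms by (auto simp: vec_eq_iff intro!: antisym)
qed

section \<open>Singular value decomposition\<close>

definition diagm :: "real^'m \<Rightarrow> 'f::star_algebra^'m^'m" where
  "diagm d = (\<chi> i j. if i = j then of_real (d $ j) else 0)"

abbreviation gram :: "'f::star_algebra^'m^'n \<Rightarrow> 'f^'m^'m" where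
  "gram M \<equiv> conj_transpose M ** M"

lemma mult_of_real: "x * of_real r = r *\<^sub>R (x :: 'f::star_algebra)"
  by (simp add: of_real_def)

lemma of_real_mult_left: "of_real r * x = r *\<^sub>R (x :: 'f::star_algebra)"
  by (simp add: of_real_def)

lemma mult_diagm_nth: "(A ** diagm d) $ i $ j = d $ j *\<^sub>R A $ i $ j"
  by (simp add: matrix_mult_nth diagm_def if_distrib mult_of_real cong: if_cong)

lemma diagm_mult: "diagm a ** diagm b = (diagm (\<chi> i. a $ i * b $ i) :: 'f::star_algebra^'m^'m)"
  by (auto simp: vec_eq_iff mult_diagm_nth) (auto simp: diagm_def of_real_def)

lemma diagm_vec: "diagm d *v x = (\<chi> i. d $ i *\<^sub>R x $ i)"
  by (simp add: vec_eq_iff matrix_vector_nth diagm_def if_distrib if_distribR of_real_mult_left cong: if_cong)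

lemma diagm_1: "diagm (\<chi> i. 1) = mat 1"
  by (simp add: vec_eq_iff diagm_def mat_def)

lemma scaleR_diagm: "c *\<^sub>R diagm d = diagm (\<chi> i. c * d $ i)"
  by (simp add: vec_eq_iff diagm_def of_real_def)

lemma diagm_minus_mat: "diagm d - c *\<^sub>R mat 1 = diagm (\<chi> i. d $ i - c)"
  by (simp add: vec_eq_iff diagm_def mat_def of_real_def scaleR_diff_left)

lemma conj_transpose_diagm [simp]: "conj_transpose (diagm d) = diagm d"
  by (simp add: vec_eq_iff diagm_def)

lemma inner_of_real: "inner (of_real a) (of_real b :: 'f::star_algebra) = a * b"
  by (simp add: of_real_def inner_1_1)

lemma inner_diagm: "inner (diagm a) (diagm b :: 'f::star_algebra^'m^'m) = inner a b"
  by (simp add: inner_vec_def diagm_def if_distrib if_distribR inner_of_real cong: if_cong)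

text \<open>Eigenvectors of the Gram matrix for distinct eigenvalues are orthogonal, so if there are as
  many eigenvalues as columns then normalized eigenvectors form a unitary matrix.\<close>

lemma eigenbasis:
  fixes M :: "('f::star_algebra, 'm::{finite,linorder}, 'n::finite) matrix"
  assumes \<sigma>: "\<sigma> \<in> weyl_chamber" and sv: "\<And>i. \<sigma> $ i \<in> singular_values M"
  shows "\<exists>V\<in>unitary. gram M = V ** diagm (\<chi> i. (\<sigma> $ i)\<^sup>2) ** conj_transpose V"
proof -
  have "\<exists>v. v \<noteq> 0 \<and> gram M *v v = (\<sigma> $ i)\<^sup>2 *\<^sub>R v" for i
    using sv[of i] by (simp add: singular_values_def)
  then obtain v where v: "\<And>i. v i \<noteq> 0" "\<And>i. gram M *v v i = (\<sigma> $ i)\<^sup>2 *\<^sub>R v i" by metis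
  define w where "w i = (1 / norm (v i)) *\<^sub>R v i" for i
  have w: "gram M *v w i = (\<sigma> $ i)\<^sup>2 *\<^sub>R w i" for i
    by (simp add: w_def matrix_vector_simps v(2))
  have unit: "hprod (w i) (w i) = 1" for i
    using v(1)[of i] by (simp add: w_def hprod_self flip: power2_norm_eq_inner)
  have orth: "hprod (w i) (w j) = 0" if "i \<noteq> j" for i j
  proof -
    have "(\<sigma> $ i)\<^sup>2 *\<^sub>R hprod (w i) (w j) = hprod (gram M *v w i) (w j)" by (simp add: w)
    also have "\<dots> = hprod (w i) (gram M *v w j)" by (simp add: hprod_matrix_vector_mult conj_transpose_mult)
    also have "\<dots> = (\<sigma> $ j)\<^sup>2 *\<^sub>R hprod (w i) (w j)" by (simp add: w)
    finally have "(\<sigma> $ i)\<^sup>2 = (\<sigma> $ j)\<^sup>2 \<or> hprod (w i) (w j) = 0" by simp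
    moreover have "(\<sigma> $ i)\<^sup>2 \<noteq> (\<sigma> $ j)\<^sup>2"
      using weyl_chamber_pos[OF \<sigma>, of i] weyl_chamber_pos[OF \<sigma>, of j] weyl_chamber_inj[OF \<sigma>] that
      by (simp add: power2_eq_iff)
    ultimately show ?thesis by blast
  qed
  define V where "V = (\<chi> a i. w i $ a)"
  have V: "V \<in> unitary" unfolding V_def using unit orth by (intro unitary_columns) simp
  have "gram M ** V = V ** diagm (\<chi> i. (\<sigma> $ i)\<^sup>2)"
    using w by (simp add: vec_eq_iff mult_diagm_nth V_def matrix_vector_nth matrix_mult_nth[of "gram M"])
  then have "gram M ** V ** conj_transpose V = V ** diagm (\<chi> i. (\<sigma> $ i)\<^sup>2) ** conj_transpose V" by simp
  then show ?thesis using V by (auto simp: unitary_cancel[OF V])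
qed

lemma unitary_vec_eq_0: "V \<in> unitary \<Longrightarrow> V *v x = 0 \<Longrightarrow> x = 0"
  by (metis matrix_vector_mul_assoc matrix_vector_mul_lid matrix_vector_simps(3) unitaryD(2))

text \<open>Together with \<open>eigenbasis\<close>, this also bounds the number of singular values: once as many as there
  are columns have been found, there are no others.\<close>

lemma singular_values_eq:
  fixes M :: "'f::star_algebra^'m^'n" and \<sigma> :: "real^'m"
  assumes V: "V \<in> unitary" and M: "gram M = V ** diagm (\<chi> i. (\<sigma> $ i)\<^sup>2) ** conj_transpose V"
    and nonneg: "\<And>i. \<sigma> $ i \<ge> 0"
  shows "singular_values M = range (($) \<sigma>)"
proof -
  have gram: "gram M *v (V *v x) = V *v (\<chi> i. (\<sigma> $ i)\<^sup>2 *\<^sub>R x $ i)" for x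
  proof -
    have "gram M *v (V *v x) = V *v (diagm (\<chi> i. (\<sigma> $ i)\<^sup>2) *v x)"
      by (simp only: M matrix_vector_mul_assoc unitary_cancel[OF V])
    then show ?thesis by (simp add: diagm_vec)
  qed
  have "s \<in> singular_values M" if "s = \<sigma> $ i" for s i
  proof -
    have "(\<chi> j. (\<sigma> $ j)\<^sup>2 *\<^sub>R axis i (1::'f) $ j) = (\<sigma> $ i)\<^sup>2 *\<^sub>R axis i 1"
      by (simp add: vec_eq_iff axis_def)
    then have "gram M *v (V *v axis i 1) = s\<^sup>2 *\<^sub>R (V *v axis i 1)"
      by (simp add: gram that matrix_vector_simps)
    moreover have "V *v axis i 1 \<noteq> 0" using unitary_vec_eq_0[OF V, of "axis i 1"] by (auto simp: axis_eq_0_iff)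
    ultimately show ?thesis using nonneg that by (auto simp: singular_values_def)
  qed
  moreover have "s \<in> range (($) \<sigma>)" if s: "s \<in> singular_values M" for s
  proof -
    obtain v where v: "v \<noteq> 0" "gram M *v v = s\<^sup>2 *\<^sub>R v" "s \<ge> 0"
      using s by (auto simp: singular_values_def)
    define x where "x = conj_transpose V *v v"
    have Vx: "V *v x = v" by (simp add: x_def matrix_vector_mul_assoc unitaryD[OF V])
    then have "V *v ((\<chi> i. (\<sigma> $ i)\<^sup>2 *\<^sub>R x $ i) - s\<^sup>2 *\<^sub>R x) = 0"
      using v(2) gram[of x] by (simp add: matrix_vector_simps)
    then have eq: "(\<sigma> $ i)\<^sup>2 *\<^sub>R x $ i = s\<^sup>2 *\<^sub>R x $ i" for i
      using unitary_vec_eq_0[OF V] by (metis (no_types, lifting) eq_iff_diff_eq_0 vec_lambda_beta vector_scaleR_component)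
    have "x \<noteq> 0" using v(1) Vx by (auto simp: matrix_vector_simps)
    then obtain i where "x $ i \<noteq> 0" by (auto simp: vec_eq_iff)
    then have "(\<sigma> $ i)\<^sup>2 = s\<^sup>2" using eq[of i] by simp
    then have "\<sigma> $ i = s" using nonneg[of i] v(3) by (simp add: power2_eq_iff_nonneg)
    then show ?thesis by blast
  qed
  ultimately show ?thesis by blast
qed

definition sv :: "('f::star_algebra, 'm::{finite,linorder}, 'n::finite) matrix \<Rightarrow> (real, 'm) vec" where
  "sv M = (THE \<sigma>. \<sigma> \<in> weyl_chamber \<and> singular_values M = range (($) \<sigma>))"

lemma sv_eqI:
  fixes M :: "('f::star_algebra, 'm::{finite,linorder}, 'n::finite) matrix"
  assumes "\<sigma> \<in> weyl_chamber" "singular_values M = range (($) \<sigma>)"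
  shows "sv M = \<sigma>" "M \<in> distinct_sv_matrices"
proof -
  show "sv M = \<sigma>"
    unfolding sv_def using assms by (intro the_equality) (auto intro: weyl_chamber_unique)
  have "card (range (($) \<sigma>)) = CARD('m)"
    using assms(1) by (intro card_image) (simp add: inj_on_def weyl_chamber_inj)
  then show "M \<in> distinct_sv_matrices"
    using assms weyl_chamber_pos[OF assms(1)] by (auto simp: distinct_sv_matrices_def less_le)
qed

lemma sv_weyl:
  fixes M :: "('f::star_algebra, 'm::{finite,linorder}, 'n::finite) matrix"
  assumes "M \<in> distinct_sv_matrices"
  shows "sv M \<in> weyl_chamber" "singular_values M = range (($) (sv M))"
proof -
  have "x > 0" if "x \<in> singular_values M" for x
  proof -
    have "x \<ge> 0" using that by (simp add: singular_values_def)
    moreover have "x \<noteq> 0" using that assms by (auto simp: distinct_sv_matrices_def)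
    ultimately show ?thesis by simp
  qed
  then obtain \<sigma> :: "(real, 'm) vec" where "\<sigma> \<in> weyl_chamber" "range (($) \<sigma>) = singular_values M"
    using weyl_chamber_exists[of "singular_values M"] assms by (auto simp: distinct_sv_matrices_def)
  then show "sv M \<in> weyl_chamber" "singular_values M = range (($) (sv M))"
    using sv_eqI(1)[of \<sigma> M] by auto
qed

text \<open>The row in which the diagonal of \<open>top_diag\<close> meets a given column. It exists if there are at
  least as many rows as columns.\<close>

definition diag_row :: "'m::{finite,linorder} \<Rightarrow> 'n::{finite,linorder}" where
  "diag_row = (SOME r. inj r \<and> (\<forall>a j. position a = position j \<longleftrightarrow> a = r j))"

lemma diag_row:
  assumes "CARD('m::{finite,linorder}) \<le> CARD('n::{finite,linorder})"
  shows "inj (diag_row :: 'm::{finite,linorder} \<Rightarrow> 'n::{finite,linorder})"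
    "position (a :: 'n::{finite,linorder}) = position (j :: 'm::{finite,linorder}) \<longleftrightarrow> a = diag_row j"
proof -
  define r where "r j = inv_into (UNIV :: 'n set) position (position (j :: 'm))" for j
  have "position j < CARD('n)" for j :: 'm
    using assms bij_betw_apply[OF bij_betw_position, of j] by auto
  then have p: "position (r j) = position j" for j
    unfolding r_def by (intro bij_betw_inv_into_right[OF bij_betw_position]) simp
  have inj: "inj (position :: 'm \<Rightarrow> nat)" "inj (position :: 'n \<Rightarrow> nat)"
    using bij_betw_position bij_betw_imp_inj_on by blast+
  have "inj r \<and> (\<forall>a j. position a = position j \<longleftrightarrow> a = r j)"
    using p inj by (metis injD injI)
  then have "\<exists>r :: 'm \<Rightarrow> 'n. inj r \<and> (\<forall>a j. position a = position j \<longleftrightarrow> a = r j)" by blast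
  from someI_ex[OF this]
  have "inj (diag_row :: 'm \<Rightarrow> 'n) \<and> (\<forall>(a :: 'n) (j :: 'm). position a = position j \<longleftrightarrow> a = diag_row j)"
    unfolding diag_row_def .
  then show "inj (diag_row :: 'm \<Rightarrow> 'n)" "position (a :: 'n) = position (j :: 'm) \<longleftrightarrow> a = diag_row j" by blast+
qed

lemma linear_top_diag: "linear (top_diag :: (real, 'm::{finite,linorder}) vec \<Rightarrow> ('f::star_algebra, 'm, 'n::{finite,linorder}) matrix)"
  by (rule linearI) (simp_all add: vec_eq_iff top_diag_def of_real_def scaleR_add_left)

lemma top_diag_mult_diagm: "top_diag a ** diagm b = top_diag (\<chi> i. a $ i * b $ i)"
  by (auto simp: vec_eq_iff mult_diagm_nth) (auto simp: top_diag_def of_real_def)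

text \<open>A decomposition with a square top block needs at least as many rows as columns. The two
  variables of type \<open>itself\<close> only name the index types.\<close>

context
  fixes column_index :: "'m::{finite,linorder} itself" and row_index :: "'n::{finite,linorder} itself"
  assumes mn: "CARD('m) \<le> CARD('n)"
begin

lemma top_diag_row: "top_diag \<sigma> = (\<chi> (a::'n) (j::'m). if a = diag_row j then of_real (\<sigma> $ j) else 0)"
  by (simp add: top_diag_def diag_row(2)[OF mn])

lemma conj_transpose_top_diag_mult:
  "conj_transpose (top_diag a :: ('f::star_algebra, 'm, 'n) matrix) ** top_diag b = diagm (\<chi> i. a $ i * b $ i)"
proof -
  have "diag_row i = (diag_row j :: 'n) \<longleftrightarrow> i = j" for i j :: 'm
    using diag_row(1)[OF mn] by (simp add: inj_eq)
  then have "star (top_diag a $ k $ i) * top_diag b $ k $ j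
      = (if k = (diag_row j :: 'n) then if i = j then of_real (a $ i * b $ i) else 0 else (0 :: 'f))"
    for i j :: 'm and k
    by (simp add: top_diag_row)
  then show ?thesis
    by (simp add: vec_eq_iff matrix_mult_nth diagm_def)
qed

text \<open>The section \<open>top_diag\<close> is an isometric embedding of Euclidean space.\<close>

lemma inner_top_diag: "inner (top_diag a :: ('f::star_algebra, 'm, 'n) matrix) (top_diag b) = inner a b"
proof -
  have "inner (top_diag a ** mat 1 :: ('f, 'm, 'n) matrix) (top_diag b) = inner (diagm (\<chi> i. 1)) (diagm (\<chi> i. a $ i * b $ i) :: ('f, 'm, 'm) matrix)"
    by (simp only: inner_matrix_mult_left conj_transpose_top_diag_mult diagm_1)
  also have "\<dots> = inner a b" unfolding inner_diagm by (simp add: inner_vec_def)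
  finally show ?thesis by simp
qed

lemma gram_svd:
  fixes U :: "('f::star_algebra, 'n, 'n) matrix" and V :: "('f, 'm, 'm) matrix"
  assumes "U \<in> unitary"
  shows "gram (U ** top_diag \<sigma> ** conj_transpose V) = V ** diagm (\<chi> i. (\<sigma> $ i)\<^sup>2) ** conj_transpose V"
proof -
  have "gram (U ** top_diag \<sigma> ** conj_transpose V)
      = V ** (conj_transpose (top_diag \<sigma>) ** (conj_transpose U ** (U ** (top_diag \<sigma> ** conj_transpose V))))"
    by (simp add: conj_transpose_mult matrix_mul_assoc)
  also have "\<dots> = V ** (conj_transpose (top_diag \<sigma> :: ('f, 'm, 'n) matrix) ** top_diag \<sigma>) ** conj_transpose V"
    by (simp only: unitary_cancel[OF assms] matrix_mul_assoc)
  finally show ?thesis by (simp add: conj_transpose_top_diag_mult power2_eq_square)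
qed

lemma sv_svd:
  fixes U :: "('f::star_algebra, 'n, 'n) matrix" and V :: "('f, 'm, 'm) matrix"
  assumes "U \<in> unitary" "V \<in> unitary" "\<sigma> \<in> weyl_chamber"
  shows "sv (U ** top_diag \<sigma> ** conj_transpose V) = \<sigma>"
    "U ** top_diag \<sigma> ** conj_transpose V \<in> distinct_sv_matrices"
  using sv_eqI[OF assms(3) singular_values_eq[OF assms(2) gram_svd[OF assms(1)]]]
    weyl_chamber_pos[OF assms(3)] by (simp_all add: less_imp_le)

lemma sv_top_diag:
  assumes "\<sigma> \<in> weyl_chamber"
  shows "sv (top_diag \<sigma> :: ('f::star_algebra, 'm, 'n) matrix) = \<sigma>"
    "(top_diag \<sigma> :: ('f::star_algebra, 'm, 'n) matrix) \<in> distinct_sv_matrices"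
  using sv_svd[where U = "mat 1 :: ('f, 'n, 'n) matrix" and V = "mat 1", OF _ _ assms]
  by (simp_all add: unitary_mat_1)

text \<open>The left singular vectors \<open>M v\<^sub>i / \<sigma>\<^sub>i\<close> are orthonormal; the remaining columns of \<open>U\<close> are
  arbitrary.\<close>

lemma svd:
  fixes M :: "('f::star_algebra, 'm, 'n) matrix"
  assumes "M \<in> distinct_sv_matrices"
  obtains U V where "U \<in> unitary" "V \<in> unitary" "M = U ** top_diag (sv M) ** conj_transpose V"
proof -
  define \<sigma> where "\<sigma> = sv M"
  have \<sigma>: "\<sigma> \<in> weyl_chamber" "\<And>i. \<sigma> $ i \<in> singular_values M"
    using sv_weyl[OF assms] by (auto simp: \<sigma>_def)
  have pos: "\<sigma> $ i > 0" for i using weyl_chamber_pos[OF \<sigma>(1)] .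
  obtain V where V: "V \<in> unitary" and gram: "gram M = V ** diagm (\<chi> i. (\<sigma> $ i)\<^sup>2) ** conj_transpose V"
    using eigenbasis[OF \<sigma>] by blast
  define X where "X = M ** V"
  have XX: "gram X = diagm (\<chi> i. (\<sigma> $ i)\<^sup>2)"
  proof -
    have "gram X = conj_transpose V ** gram M ** V"
      by (simp add: X_def conj_transpose_mult matrix_mul_assoc)
    also have "\<dots> = conj_transpose V ** (V ** (diagm (\<chi> i. (\<sigma> $ i)\<^sup>2) ** conj_transpose V ** V))"
      by (simp only: gram matrix_mul_assoc)
    finally show ?thesis by (simp only: unitary_cancel[OF V])
  qed
  define x where "x j = (1 / \<sigma> $ j) *\<^sub>R (\<chi> a. X $ a $ j)" for j
  have "hprod (x i) (x j) = (if i = j then 1 else 0)" for i j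
  proof -
    have "hprod (\<chi> a. X $ a $ i) (\<chi> a. X $ a $ j) = gram X $ i $ j"
      by (simp add: hprod_def matrix_mult_nth)
    then show ?thesis using pos[of j]
      by (simp add: x_def XX diagm_def of_real_def power2_eq_square)
  qed
  then have "\<exists>w. (\<forall>a\<in>range (diag_row :: 'm \<Rightarrow> 'n). w a = x (inv diag_row a))
      \<and> (\<forall>a b. hprod (w a) (w b) = (if a = b then 1 else 0))"
    using diag_row(1)[OF mn] by (intro extend_orthonormal) (auto simp: inv_f_f inj_eq)
  then obtain w where w: "\<And>j. w (diag_row j :: 'n) = x j"
      "\<And>a b. hprod (w a) (w b) = (if a = b then 1 else 0)"
    using diag_row(1)[OF mn] by (auto simp: inv_f_f)
  define U where "U = (\<chi> a b. w b $ a)"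
  have U: "U \<in> unitary" unfolding U_def using w(2) by (rule unitary_columns)
  have "X = U ** top_diag \<sigma>"
    using pos
    by (simp add: vec_eq_iff matrix_mult_nth top_diag_row U_def if_distrib mult_of_real w(1) x_def
        less_imp_neq[THEN not_sym] cong: if_cong)
  then have "M = U ** top_diag \<sigma> ** conj_transpose V"
    using unitary_cancel(3)[OF V, of M] by (simp add: X_def)
  then show ?thesis using that U V by (simp add: \<sigma>_def)
qed

section \<open>Orbits\<close>

lemma orbit_action:
  assumes "U \<in> unitary" "V \<in> unitary"
  shows "orbit (U ** M ** conj_transpose V :: ('f::star_algebra, 'm, 'n) matrix) = orbit M"
proof -
  have sub: "orbit (U ** M ** conj_transpose V) \<subseteq> orbit M"
    if "U \<in> unitary" "V \<in> unitary" for U :: "('f, 'n, 'n) matrix" and V :: "('f, 'm, 'm) matrix" and M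
  proof
    fix X assume "X \<in> orbit (U ** M ** conj_transpose V)"
    then obtain U' V' where U': "U' \<in> unitary" "V' \<in> unitary"
        and X: "X = U' ** (U ** M ** conj_transpose V) ** conj_transpose V'"
      by (auto simp: orbit_def action_def)
    have "X = action (U' ** U, V' ** V) M"
      by (simp add: X action_def conj_transpose_mult matrix_mul_assoc)
    moreover have "(U' ** U, V' ** V) \<in> unitary \<times> unitary" using U' that by (simp add: unitary_mult)
    ultimately show "X \<in> orbit M" unfolding orbit_def by blast
  qed
  have "M = conj_transpose U ** (U ** M ** conj_transpose V) ** conj_transpose (conj_transpose V)"
    by (simp add: unitary_cancel[OF assms(2)] matrix_mul_assoc[symmetric, of _ U] matrix_mul_assoc[symmetric, of U]
        unitary_cancel[OF assms(1)])
  then have "orbit M \<subseteq> orbit (U ** M ** conj_transpose V)"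
    using sub[OF unitary_conj_transpose[OF assms(1)] unitary_conj_transpose[OF assms(2)]] by metis
  then show ?thesis using sub[OF assms] by blast
qed

text \<open>Singular values are invariant under the action, since a decomposition of \<open>N\<close> is turned into one
  of \<open>M\<close> with the same diagonal part. Conversely a matrix lies in the orbit of its diagonal part,
  which is determined by its singular values.\<close>

lemma orbit_eq_iff:
  fixes M N :: "('f::star_algebra, 'm, 'n) matrix"
  assumes "M \<in> distinct_sv_matrices" "N \<in> distinct_sv_matrices"
  shows "orbit M = orbit N \<longleftrightarrow> sv M = sv N"
proof
  assume "orbit M = orbit N"
  moreover have "M \<in> orbit M"
    unfolding orbit_def mem_Collect_eq
    by (rule exI[of _ "(mat 1, mat 1)"]) (simp add: action_def unitary_mat_1)
  ultimately have "M \<in> orbit N" by simp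
  then obtain U V where UV: "U \<in> unitary" "V \<in> unitary" "M = U ** N ** conj_transpose V"
    by (auto simp: orbit_def action_def)
  obtain U' V' where N: "U' \<in> unitary" "V' \<in> unitary" "N = U' ** top_diag (sv N) ** conj_transpose V'"
    using svd[OF assms(2)] .
  have "M = U ** (U' ** top_diag (sv N) ** conj_transpose V') ** conj_transpose V"
    unfolding UV(3) using N(3) by simp
  also have "\<dots> = (U ** U') ** top_diag (sv N) ** conj_transpose (V ** V')"
    by (simp add: conj_transpose_mult matrix_mul_assoc)
  finally show "sv M = sv N"
    using sv_svd(1)[OF unitary_mult[OF UV(1) N(1)] unitary_mult[OF UV(2) N(2)] sv_weyl(1)[OF assms(2)]]
    by simp
next
  assume "sv M = sv N"
  moreover have "orbit X = orbit (top_diag (sv X))" if X: "X \<in> distinct_sv_matrices" for X :: "('f, 'm, 'n) matrix"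
  proof -
    obtain U V where "U \<in> unitary" "V \<in> unitary" "X = U ** top_diag (sv X) ** conj_transpose V"
      using svd[OF X] .
    then show ?thesis using orbit_action[of U V "top_diag (sv X)"] by simp
  qed
  ultimately show "orbit M = orbit N" using assms by simp
qed

end

section \<open>Continuity of the singular values\<close>

context
  fixes column_index :: "'m::{finite,linorder} itself" and row_index :: "'n::{finite,linorder} itself"
  assumes mn: "CARD('m) \<le> CARD('n)"
begin

text \<open>
  For \<open>N\<close> near \<open>M\<close>, the unit eigenvectors of \<open>M\<^sup>*M\<close> are approximate eigenvectors of \<open>N\<^sup>*N\<close>, so \<open>N\<close> has
  a singular value close to each \<open>\<sigma>\<^sub>i\<close>. As the Weyl chamber is open, these values are still distinct,
  positive and in decreasing order; and there is one for each column, so they are all the singular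
  values of \<open>N\<close>.
\<close>

lemma sv_near:
  fixes M :: "('f::star_algebra, 'm, 'n) matrix"
  assumes M: "M \<in> distinct_sv_matrices" and "e > 0"
  shows "\<forall>\<^sub>F N in nhds M. N \<in> distinct_sv_matrices \<and> dist (sv N) (sv M) < e"
proof -
  define \<sigma> where "\<sigma> = sv M"
  have \<sigma>: "\<sigma> \<in> weyl_chamber" "\<And>i. \<sigma> $ i \<in> singular_values M"
    using sv_weyl[OF M] by (auto simp: \<sigma>_def)
  obtain V where V: "V \<in> unitary" and gram: "gram M = V ** diagm (\<chi> i. (\<sigma> $ i)\<^sup>2) ** conj_transpose V"
    using eigenbasis[OF \<sigma>] by blast
  obtain e' where e': "e' > 0" "e' \<le> e" "ball \<sigma> e' \<subseteq> weyl_chamber"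
  proof -
    obtain r where "r > 0" "ball \<sigma> r \<subseteq> weyl_chamber"
      using open_weyl_chamber \<sigma>(1) open_contains_ball by blast
    then show ?thesis
      using that[of "min r e"] subset_ball[of "min r e" r \<sigma>] \<open>e > 0\<close> by auto
  qed
  \<comment> \<open>If all coordinates are closer than \<open>c\<close>, the vectors are closer than \<open>e'\<close> in the sum norm.\<close>
  define c where "c = e' / CARD('m)"
  have "c > 0" using e'(1) by (simp add: c_def)
  have ev: "\<forall>\<^sub>F N in nhds M. \<exists>s\<in>singular_values N. \<bar>s - \<sigma> $ i\<bar> < c" for i
  proof -
    have pos: "\<sigma> $ i > 0" using weyl_chamber_pos[OF \<sigma>(1)] .
    define w where "w = V *v axis i 1"
    have "inner w w = inner (axis i 1) ((conj_transpose V ** V) *v axis i (1::'f))"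
      by (simp add: w_def inner_matrix_vector_mult matrix_vector_mul_assoc)
    then have w: "norm w = 1"
      by (simp add: unitaryD[OF V] norm_eq_sqrt_inner inner_axis_axis inner_1_1)
    have "gram M *v w = V *v (diagm (\<chi> i. (\<sigma> $ i)\<^sup>2) *v axis i 1)"
      by (simp only: gram w_def matrix_vector_mul_assoc unitary_cancel[OF V])
    also have "diagm (\<chi> i. (\<sigma> $ i)\<^sup>2) *v axis i (1::'f) = (\<sigma> $ i)\<^sup>2 *\<^sub>R axis i 1"
      by (simp add: vec_eq_iff diagm_vec axis_def)
    finally have Mw: "gram M *v w = (\<sigma> $ i)\<^sup>2 *\<^sub>R w"
      by (simp add: w_def matrix_vector_simps)
    have "\<forall>\<^sub>F l in nhds ((\<sigma> $ i)\<^sup>2). l > 0 \<and> dist (sqrt l) (\<sigma> $ i) < c"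
    proof (rule eventually_conj)
      show "\<forall>\<^sub>F l in nhds ((\<sigma> $ i)\<^sup>2). l > 0"
        using eventually_nhds_in_open[of "{0<..}" "(\<sigma> $ i)\<^sup>2"] zero_less_power[OF pos, of 2]
        by simp
      have "(sqrt \<longlongrightarrow> sqrt ((\<sigma> $ i)\<^sup>2)) (nhds ((\<sigma> $ i)\<^sup>2))"
        by (intro tendsto_real_sqrt filterlim_ident)
      then show "\<forall>\<^sub>F l in nhds ((\<sigma> $ i)\<^sup>2). dist (sqrt l) (\<sigma> $ i) < c"
        using tendstoD[OF _ \<open>c > 0\<close>] pos by fastforce
    qed
    then obtain d where d: "d > 0" "\<And>l. dist l ((\<sigma> $ i)\<^sup>2) < d \<Longrightarrow> l > 0 \<and> dist (sqrt l) (\<sigma> $ i) < c"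
      by (auto simp: eventually_nhds_metric)
    have "((\<lambda>N. gram N *v w) \<longlongrightarrow> gram M *v w) (nhds M)"
      by (intro bounded_bilinear.tendsto[OF bounded_bilinear_matrix_vector_mult]
          bounded_bilinear.tendsto[OF bounded_bilinear_matrix_mult]
          bounded_linear.tendsto[OF bounded_linear_conj_transpose] filterlim_ident tendsto_const)
    then have "\<forall>\<^sub>F N in nhds M. dist (gram N *v w) (gram M *v w) < d"
      using tendstoD \<open>d > 0\<close> by blast
    then show ?thesis
    proof (rule eventually_mono)
      fix N :: "('f, 'm, 'n) matrix" assume "dist (gram N *v w) (gram M *v w) < d"
      then have "norm (gram N *v w - (\<sigma> $ i)\<^sup>2 *\<^sub>R w) < d" by (simp add: Mw dist_norm)
      moreover have "inner (gram N *v x) y = inner x (gram N *v y)" for x y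
        by (simp add: inner_matrix_vector_mult conj_transpose_mult)
      ultimately obtain l v where l: "v \<noteq> 0" "gram N *v v = l *\<^sub>R v" "\<bar>l - (\<sigma> $ i)\<^sup>2\<bar> < d"
        using eigenvalue_near[OF linear_matrix_vector_mult _ w] by blast
      then have "l > 0" "\<bar>sqrt l - \<sigma> $ i\<bar> < c" using d(2)[of l] by (auto simp: dist_real_def)
      moreover from this have "sqrt l \<in> singular_values N"
        using l by (auto simp: singular_values_def)
      ultimately show "\<exists>s\<in>singular_values N. \<bar>s - \<sigma> $ i\<bar> < c" by blast
    qed
  qed
  have "\<forall>\<^sub>F N in nhds M. \<forall>i. \<exists>s\<in>singular_values N. \<bar>s - \<sigma> $ i\<bar> < c"
    by (rule eventually_all_finite) (rule ev)
  then show ?thesis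
  proof (rule eventually_mono)
    fix N :: "('f, 'm, 'n) matrix" assume "\<forall>i. \<exists>s\<in>singular_values N. \<bar>s - \<sigma> $ i\<bar> < c"
    then obtain s where s: "\<And>i. s i \<in> singular_values N" "\<And>i. \<bar>s i - \<sigma> $ i\<bar> < c" by metis
    define \<tau> where "\<tau> = (\<chi> i. s i)"
    have "norm (\<tau> - \<sigma>) \<le> (\<Sum>i\<in>UNIV. \<bar>(\<tau> - \<sigma>) $ i\<bar>)" by (rule norm_le_l1_cart)
    also have "\<dots> < (\<Sum>i\<in>(UNIV :: 'm set). c)"
      using s(2) by (intro sum_strict_mono) (auto simp: \<tau>_def)
    also have "\<dots> = e'" by (simp add: c_def)
    finally have dist: "dist \<tau> \<sigma> < e'" by (simp add: dist_norm)
    then have \<tau>: "\<tau> \<in> weyl_chamber" using e'(3) by (auto simp: dist_commute)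
    obtain V where V: "V \<in> unitary" "gram N = V ** diagm (\<chi> i. (\<tau> $ i)\<^sup>2) ** conj_transpose V"
      using eigenbasis[OF \<tau>, of N] s(1) by (auto simp: \<tau>_def)
    have "sv N = \<tau>" "N \<in> distinct_sv_matrices"
      using sv_eqI[OF \<tau> singular_values_eq[OF V]] weyl_chamber_pos[OF \<tau>] by (simp_all add: less_imp_le)
    then show "N \<in> distinct_sv_matrices \<and> dist (sv N) (sv M) < e"
      using dist e'(2) by (simp add: \<sigma>_def)
  qed
qed

lemma open_distinct_sv_matrices: "open (distinct_sv_matrices :: ('f::star_algebra, 'm, 'n) matrix set)"
proof (subst open_subopen, intro ballI)
  fix M :: "('f, 'm, 'n) matrix" assume "M \<in> distinct_sv_matrices"
  then have "\<forall>\<^sub>F N in nhds M. N \<in> distinct_sv_matrices"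
    using sv_near[of M 1] by (simp add: eventually_conj_iff)
  then show "\<exists>T. open T \<and> M \<in> T \<and> T \<subseteq> distinct_sv_matrices" by (auto simp: eventually_nhds)
qed

lemma continuous_on_sv: "continuous_on distinct_sv_matrices (sv :: ('f::star_algebra, 'm, 'n) matrix \<Rightarrow> _)"
proof -
  have "isCont sv M" if "M \<in> distinct_sv_matrices" for M :: "('f, 'm, 'n) matrix"
    unfolding isCont_def tendsto_iff eventually_at_filter
  proof (intro allI impI)
    fix e :: real assume "e > 0"
    show "\<forall>\<^sub>F N in nhds M. N \<noteq> M \<longrightarrow> N \<in> UNIV \<longrightarrow> dist (sv N) (sv M) < e"
      using sv_near[OF that \<open>e > 0\<close>] by (rule eventually_mono) simp
  qed
  then show ?thesis by (simp add: continuous_at_imp_continuous_on)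
qed

end

section \<open>The singular projections and the derivative of the singular values\<close>

text \<open>The Lagrange interpolation polynomial of the nodes \<open>l\<close> with value \<open>1\<close> at \<open>l i\<close> and value \<open>0\<close> at
  the other nodes \<open>l j\<close>, evaluated at the matrix \<open>G\<close>. The nodes come as a list because products over
  finite sets need a commutative multiplication.\<close>

primrec lagrange :: "('f::star_algebra, 'm, 'm) matrix \<Rightarrow> ('m \<Rightarrow> real) \<Rightarrow> 'm::finite \<Rightarrow> 'm list
    \<Rightarrow> ('f, 'm, 'm) matrix" where
  "lagrange G l i [] = mat 1"
| "lagrange G l i (j # js) = (inverse (l i - l j) *\<^sub>R (G - l j *\<^sub>R mat 1)) ** lagrange G l i js"

lemma lagrange_diagm:
  assumes V: "V \<in> unitary"
  shows "lagrange (V ** diagm (\<chi> k. l k) ** conj_transpose V) l i js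
    = V ** diagm (\<chi> k. prod_list (map (\<lambda>j. inverse (l i - l j) * (l k - l j)) js)) ** conj_transpose V"
proof (induction js)
  case Nil
  then show ?case by (simp add: diagm_1 unitaryD[OF V])
next
  case (Cons j js)
  let ?D = "\<lambda>d. V ** diagm d ** conj_transpose V"
  have mult: "?D a ** ?D b = ?D (\<chi> k. a $ k * b $ k)" for a b
  proof -
    have "?D a ** ?D b = V ** diagm a ** (conj_transpose V ** (V ** (diagm b ** conj_transpose V)))"
      by (simp only: matrix_mul_assoc)
    also have "\<dots> = V ** (diagm a ** diagm b) ** conj_transpose V"
      by (simp only: unitary_cancel[OF V] matrix_mul_assoc)
    finally show ?thesis by (simp only: diagm_mult)
  qed
  have "?D (\<chi> k. l k) - c *\<^sub>R mat 1 = ?D (\<chi> k. l k - c)" for c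
  proof -
    have "?D (\<chi> k. l k) - c *\<^sub>R mat 1 = V ** (diagm (\<chi> k. l k) - c *\<^sub>R mat 1) ** conj_transpose V"
      by (simp add: matrix_mult_simps unitaryD[OF V])
    then show ?thesis by (simp add: diagm_minus_mat)
  qed
  moreover have "c *\<^sub>R ?D a = ?D (\<chi> k. c * a $ k)" for c a
    by (simp add: matrix_mult_simps flip: scaleR_diagm)
  ultimately have "lagrange (?D (\<chi> k. l k)) l i (j # js)
      = ?D (\<chi> k. inverse (l i - l j) * (l k - l j))
        ** ?D (\<chi> k. prod_list (map (\<lambda>j. inverse (l i - l j) * (l k - l j)) js))"
    by (simp add: Cons.IH)
  then show ?case by (simp add: mult)
qed

lemma Ck_on_lagrange:
  assumes "open S" "Ck_on k G S" "\<And>j. Ck_on k (\<lambda>x. l x j) S"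
    and "\<And>x j. x \<in> S \<Longrightarrow> j \<in> set js \<Longrightarrow> l x i \<noteq> l x j"
  shows "Ck_on k (\<lambda>x. lagrange (G x) (l x) i js) S"
  using assms(4)
proof (induction js)
  case Nil
  then show ?case by simp
next
  case (Cons j js)
  have diff: "Ck_on k (\<lambda>x. f x - g x) S" if "Ck_on k f S" "Ck_on k g S"
    for f g :: "_ \<Rightarrow> 'x::real_normed_vector"
    using Ck_on_add[OF \<open>open S\<close> that(1) Ck_on_linear_image[OF bounded_linear_minus[OF bounded_linear_ident] \<open>open S\<close> that(2)]]
    by simp
  show ?case
    using assms(1-3) Cons
    by (auto intro!: Ck_on_bilinear[OF bounded_bilinear_matrix_mult] Ck_on_inverse diff
        Ck_on_bilinear[OF bounded_bilinear_scaleR])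
qed

definition others :: "'m::finite \<Rightarrow> 'm list" where "others i = (SOME js. set js = UNIV - {i})"

lemma set_others: "set (others i) = UNIV - {i}"
  unfolding others_def by (rule someI_ex) (simp add: finite_list)

text \<open>In terms of unit singular vectors these are \<open>v\<^sub>i v\<^sub>i\<^sup>*\<close> and \<open>u\<^sub>i v\<^sub>i\<^sup>*\<close>, by \<open>proj_svd\<close> below. The
  singular vectors themselves are determined only up to a common scalar of norm \<open>1\<close>, which cancels
  in the projections; these are functions of \<open>M\<close>, and given \<open>sv M\<close> they are even rational.\<close>

definition right_proj :: "('f::star_algebra, 'm::{finite,linorder}, 'n::finite) matrix \<Rightarrow> 'm \<Rightarrow> ('f, 'm, 'm) matrix"
  where "right_proj M i = lagrange (gram M) (\<lambda>j. (sv M $ j)\<^sup>2) i (others i)"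

definition sing_proj :: "('f::star_algebra, 'm::{finite,linorder}, 'n::finite) matrix \<Rightarrow> 'm \<Rightarrow> ('f, 'm, 'n) matrix"
  where "sing_proj M i = inverse (sv M $ i) *\<^sub>R (M ** right_proj M i)"

lemma sq_weyl_chamber_inj: "\<sigma> \<in> weyl_chamber \<Longrightarrow> (\<sigma> $ i)\<^sup>2 = (\<sigma> $ j)\<^sup>2 \<longleftrightarrow> i = j"
  using weyl_chamber_pos[of \<sigma> i] weyl_chamber_pos[of \<sigma> j] weyl_chamber_inj[of \<sigma> i j]
  by (simp add: power2_eq_iff_nonneg)

lemma Ck_on_right_proj:
  assumes S: "open S" "S \<subseteq> distinct_sv_matrices" and sv: "Ck_on k sv S"
  shows "Ck_on k (\<lambda>M. right_proj M i) S"
  unfolding right_proj_def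
proof (rule Ck_on_lagrange[OF S(1)])
  show "Ck_on k gram S"
    by (intro Ck_on_bilinear[OF bounded_bilinear_matrix_mult] Ck_on_ident
        Ck_on_bounded_linear[OF bounded_linear_conj_transpose] S(1))
  show "Ck_on k (\<lambda>M. (sv M $ j)\<^sup>2) S" for j
    unfolding power2_eq_square
    by (intro Ck_on_bilinear[OF bounded_bilinear_mult] Ck_on_linear_image[OF bounded_linear_vec_nth] S sv)
  show "(sv M $ i)\<^sup>2 \<noteq> (sv M $ j)\<^sup>2" if "M \<in> S" "j \<in> set (others i)" for M j
  proof -
    have "sv M \<in> weyl_chamber" using S(2) that(1) sv_weyl(1) by blast
    then show ?thesis using that(2) by (auto simp: sq_weyl_chamber_inj set_others)
  qed
qed

lemma Ck_on_sing_proj: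
  assumes S: "open S" "S \<subseteq> distinct_sv_matrices" and sv: "Ck_on k sv S"
  shows "Ck_on k (\<lambda>M. sing_proj M i) S"
  unfolding sing_proj_def
proof (intro Ck_on_bilinear[OF bounded_bilinear_scaleR] Ck_on_bilinear[OF bounded_bilinear_matrix_mult]
    Ck_on_inverse Ck_on_right_proj Ck_on_linear_image[OF bounded_linear_vec_nth] Ck_on_ident assms)
  show "sv M $ i \<noteq> 0" if "M \<in> S" for M
    using weyl_chamber_pos[OF sv_weyl(1), of M i] S(2) that by auto
qed

context
  fixes column_index :: "'m::{finite,linorder} itself" and row_index :: "'n::{finite,linorder} itself"
  assumes mn: "CARD('m) \<le> CARD('n)"
begin

lemma proj_svd:
  fixes M :: "('f::star_algebra, 'm, 'n) matrix"
  assumes M: "M \<in> distinct_sv_matrices" and U: "U \<in> unitary" and V: "V \<in> unitary"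
    and svd: "M = U ** top_diag (sv M) ** conj_transpose V"
  shows "right_proj M i = V ** diagm (axis i 1) ** conj_transpose V"
    and "sing_proj M i = U ** top_diag (axis i 1) ** conj_transpose V"
proof -
  let ?\<sigma> = "sv M"
  have gram: "gram M = V ** diagm (\<chi> k. (?\<sigma> $ k)\<^sup>2) ** conj_transpose V"
    using gram_svd[OF mn U, of "sv M" V] svd by simp
  have "prod_list (map (\<lambda>j. inverse ((?\<sigma> $ i)\<^sup>2 - (?\<sigma> $ j)\<^sup>2) * ((?\<sigma> $ k)\<^sup>2 - (?\<sigma> $ j)\<^sup>2)) (others i))
      = axis i 1 $ k" for k
  proof (cases "k = i")
    case True
    have "map (\<lambda>j. inverse ((?\<sigma> $ i)\<^sup>2 - (?\<sigma> $ j)\<^sup>2) * ((?\<sigma> $ k)\<^sup>2 - (?\<sigma> $ j)\<^sup>2)) (others i)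
        = map (\<lambda>j. 1) (others i)"
      using True set_others[of i] sq_weyl_chamber_inj[OF sv_weyl(1)[OF M], of i]
      by (intro map_cong) auto
    moreover have "prod_list (map (\<lambda>j. 1 :: real) js) = 1" for js :: "'m list" by (induction js) auto
    moreover have "axis i 1 $ k = (1 :: real)" using True by (simp add: axis_def)
    ultimately show ?thesis by (simp only:)
  next
    case False
    then have "k \<in> set (others i)" using set_others[of i] by simp
    then have "0 \<in> set (map (\<lambda>j. inverse ((?\<sigma> $ i)\<^sup>2 - (?\<sigma> $ j)\<^sup>2) * ((?\<sigma> $ k)\<^sup>2 - (?\<sigma> $ j)\<^sup>2)) (others i))"
      by (force simp: image_iff)
    then show ?thesis using False by (simp add: prod_list_zero_iff axis_def)
  qed
  then show E: "right_proj M i = V ** diagm (axis i 1) ** conj_transpose V"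
    unfolding right_proj_def gram lagrange_diagm[OF V] by simp
  have "M ** right_proj M i
      = U ** top_diag (sv M) ** (conj_transpose V ** (V ** (diagm (axis i 1) ** conj_transpose V)))"
    using svd by (simp add: E matrix_mul_assoc)
  also have "\<dots> = U ** (top_diag (sv M) ** diagm (axis i 1)) ** conj_transpose V"
    by (simp only: unitary_cancel[OF V] matrix_mul_assoc)
  also have "top_diag (sv M) ** diagm (axis i 1) = (top_diag (sv M $ i *\<^sub>R axis i 1) :: ('f, 'm, 'n) matrix)"
    unfolding top_diag_mult_diagm by (rule arg_cong[of _ _ top_diag]) (simp add: vec_eq_iff axis_def)
  also have "\<dots> = sv M $ i *\<^sub>R top_diag (axis i 1)"
    using linear_scale[OF linear_top_diag] .
  finally show "sing_proj M i = U ** top_diag (axis i 1) ** conj_transpose V"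
    using weyl_chamber_pos[OF sv_weyl(1)[OF M], of i]
    by (simp add: sing_proj_def matrix_mult_simps)
qed

lemma proj_rules:
  fixes M :: "('f::star_algebra, 'm, 'n) matrix"
  assumes M: "M \<in> distinct_sv_matrices"
  shows "M ** right_proj M i = sv M $ i *\<^sub>R sing_proj M i"
    and "conj_transpose M ** sing_proj M i = sv M $ i *\<^sub>R right_proj M i"
    and "sing_proj M i ** conj_transpose (right_proj M i) = sing_proj M i"
    and "inner (sing_proj M i) (sing_proj M j) = (if i = j then 1 else 0)"
    and "inner (right_proj M i) (right_proj M i) = 1"
proof -
  obtain U V where U: "U \<in> unitary" and V: "V \<in> unitary" and svd: "M = U ** top_diag (sv M) ** conj_transpose V"
    using svd[OF mn M] .
  note proj = proj_svd[OF M U V svd]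
  have pos: "sv M $ i > 0" for i using weyl_chamber_pos[OF sv_weyl(1)[OF M]] .
  show "M ** right_proj M i = sv M $ i *\<^sub>R sing_proj M i"
    using pos[of i] by (simp add: sing_proj_def)
  have "conj_transpose M ** sing_proj M i
      = V ** (conj_transpose (top_diag (sv M)) ** (conj_transpose U ** (U ** (top_diag (axis i 1) ** conj_transpose V))))"
    by (subst svd) (simp add: proj conj_transpose_mult matrix_mul_assoc)
  also have "\<dots> = V ** (conj_transpose (top_diag (sv M) :: ('f, 'm, 'n) matrix) ** top_diag (axis i 1)) ** conj_transpose V"
    by (simp only: unitary_cancel[OF U] matrix_mul_assoc)
  also have "conj_transpose (top_diag (sv M) :: ('f, 'm, 'n) matrix) ** top_diag (axis i 1)
      = sv M $ i *\<^sub>R diagm (axis i 1)"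
    unfolding conj_transpose_top_diag_mult[OF mn] scaleR_diagm
    by (rule arg_cong[of _ _ diagm]) (simp add: vec_eq_iff axis_def)
  finally show "conj_transpose M ** sing_proj M i = sv M $ i *\<^sub>R right_proj M i"
    by (simp add: proj matrix_mult_simps)
  have "sing_proj M i ** conj_transpose (right_proj M i)
      = U ** top_diag (axis i 1) ** (conj_transpose V ** (V ** (diagm (axis i 1) ** conj_transpose V)))"
    by (simp add: proj conj_transpose_mult matrix_mul_assoc)
  also have "\<dots> = U ** (top_diag (axis i 1) ** diagm (axis i 1)) ** conj_transpose V"
    by (simp only: unitary_cancel[OF V] matrix_mul_assoc)
  also have "top_diag (axis i 1) ** diagm (axis i 1) = (top_diag (axis i 1) :: ('f, 'm, 'n) matrix)"
    unfolding top_diag_mult_diagm by (rule arg_cong[of _ _ top_diag]) (simp add: vec_eq_iff axis_def)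
  finally show "sing_proj M i ** conj_transpose (right_proj M i) = sing_proj M i"
    by (simp add: proj)
  show "inner (sing_proj M i) (sing_proj M j) = (if i = j then 1 else 0)"
    by (simp add: proj inner_unitary[OF U V] inner_top_diag[OF mn] inner_axis_axis)
  show "inner (right_proj M i) (right_proj M i) = 1"
    by (simp add: proj inner_unitary[OF V V] inner_diagm inner_axis_axis)
qed

text \<open>
  Write \<open>E\<close>, \<open>P\<close> for the projections of \<open>M\<close> and \<open>F\<close>, \<open>Q\<close> for those of \<open>N\<close>. Pairing \<open>N F = \<tau> Q\<close> and
  \<open>M\<^sup>* P = \<sigma> E\<close> gives \<open>\<langle>N - M, P F\<^sup>*\<rangle> = \<tau> \<langle>Q, P\<rangle> - \<sigma> \<langle>F, E\<rangle>\<close>, and with the roles exchanged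
  \<open>\<langle>N - M, Q E\<^sup>*\<rangle> = \<tau> \<langle>F, E\<rangle> - \<sigma> \<langle>Q, P\<rangle>\<close>. In the sum the difference \<open>\<tau> - \<sigma>\<close> factors out.
\<close>

lemma sv_difference:
  fixes M N :: "('f::star_algebra, 'm, 'n) matrix"
  assumes M: "M \<in> distinct_sv_matrices" and N: "N \<in> distinct_sv_matrices"
  shows "(sv N $ i - sv M $ i)
      * (inner (sing_proj N i) (sing_proj M i) + inner (right_proj N i) (right_proj M i))
    = inner (N - M) (sing_proj M i ** conj_transpose (right_proj N i)
        + sing_proj N i ** conj_transpose (right_proj M i))"
proof -
  define P Q E F where "P = sing_proj M i" and "Q = sing_proj N i"
    and "E = right_proj M i" and "F = right_proj N i"
  have "inner N (P ** conj_transpose F) = inner (N ** F) P"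
    by (simp add: inner_matrix_mult_right)
  also have "\<dots> = sv N $ i * inner Q P" by (simp add: proj_rules(1)[OF N] F_def Q_def)
  finally have 1: "inner N (P ** conj_transpose F) = sv N $ i * inner Q P" .
  have "inner M (P ** conj_transpose F) = inner F (conj_transpose M ** P)"
    by (simp add: inner_matrix_mult_right[symmetric] inner_matrix_mult_left)
  also have "\<dots> = sv M $ i * inner F E" by (simp add: proj_rules(2)[OF M] P_def E_def)
  finally have 2: "inner M (P ** conj_transpose F) = sv M $ i * inner F E" .
  have "inner N (Q ** conj_transpose E) = inner E (conj_transpose N ** Q)"
    by (simp add: inner_matrix_mult_right[symmetric] inner_matrix_mult_left)
  also have "\<dots> = sv N $ i * inner F E" by (simp add: proj_rules(2)[OF N] Q_def F_def inner_commute)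
  finally have 3: "inner N (Q ** conj_transpose E) = sv N $ i * inner F E" .
  have "inner M (Q ** conj_transpose E) = inner (M ** E) Q"
    by (simp add: inner_matrix_mult_right)
  also have "\<dots> = sv M $ i * inner Q P" by (simp add: proj_rules(1)[OF M] E_def P_def inner_commute)
  finally have 4: "inner M (Q ** conj_transpose E) = sv M $ i * inner Q P" .
  show ?thesis
    unfolding P_def[symmetric] Q_def[symmetric] E_def[symmetric] F_def[symmetric]
    by (simp add: inner_add_right inner_diff_left 1 2 3 4 algebra_simps)
qed

text \<open>As \<open>N\<close> tends to \<open>M\<close> the projections converge, since \<open>sv\<close> is continuous. So in the identity
  \<open>sv_difference\<close> the factor on the left tends to \<open>2\<close> and the gradient on the right to twice the
  singular projection.\<close>

lemma has_derivative_sv: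
  fixes M :: "('f::star_algebra, 'm, 'n) matrix"
  assumes M: "M \<in> distinct_sv_matrices"
  shows "(sv has_derivative (\<lambda>X. \<chi> i. inner X (sing_proj M i))) (at M)"
proof -
  let ?S = "distinct_sv_matrices :: ('f, 'm, 'n) matrix set"
  have "open ?S" by (rule open_distinct_sv_matrices[OF mn])
  have sv: "Ck_on 0 (sv :: ('f, 'm, 'n) matrix \<Rightarrow> _) ?S" using continuous_on_sv[OF mn] by simp
  have "((\<lambda>N. sv N $ i) has_derivative (\<lambda>X. inner X (sing_proj M i))) (at M)" for i
  proof -
    define P Q where "P = sing_proj M i" and "Q = right_proj M i"
    define c where "c N = inner (sing_proj N i) P + inner (right_proj N i) Q" for N :: "('f, 'm, 'n) matrix"
    define H where "H N = P ** conj_transpose (right_proj N i) + sing_proj N i ** conj_transpose Q"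
      for N :: "('f, 'm, 'n) matrix"
    have cont: "isCont (\<lambda>N. sing_proj N i) M" "isCont (\<lambda>N. right_proj N i) M"
      using Ck_on_sing_proj[OF \<open>open ?S\<close> _ sv, of i] Ck_on_right_proj[OF \<open>open ?S\<close> _ sv, of i] M
      by (simp_all add: continuous_on_eq_continuous_at[OF \<open>open ?S\<close>])
    then have lim: "((\<lambda>N. sing_proj N i) \<longlongrightarrow> P) (at M)" "((\<lambda>N. right_proj N i) \<longlongrightarrow> Q) (at M)"
      by (simp_all add: isCont_def P_def Q_def)
    have "(c \<longlongrightarrow> inner P P + inner Q Q) (at M)"
      unfolding c_def by (intro tendsto_intros lim)
    then have c: "(c \<longlongrightarrow> 2) (at M)" using proj_rules(4,5)[OF M] by (simp add: P_def Q_def)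
    have "(H \<longlongrightarrow> P ** conj_transpose Q + P ** conj_transpose Q) (at M)"
      unfolding H_def
      by (intro tendsto_add tendsto_const lim bounded_bilinear.tendsto[OF bounded_bilinear_matrix_mult]
          bounded_linear.tendsto[OF bounded_linear_conj_transpose])
    then have H: "(H \<longlongrightarrow> 2 *\<^sub>R P) (at M)"
      using proj_rules(3)[OF M] by (simp add: P_def Q_def scaleR_2)
    have "((\<lambda>N. inverse (c N) *\<^sub>R H N) \<longlongrightarrow> inverse 2 *\<^sub>R (2 *\<^sub>R P)) (at M)"
      by (intro tendsto_intros c H) simp
    then have lim: "((\<lambda>N. inverse (c N) *\<^sub>R H N) \<longlongrightarrow> P) (at M)" by simp
    have "\<forall>\<^sub>F N in at M. N \<in> ?S"
      using M \<open>open ?S\<close> by (simp add: eventually_at_in_open')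
    moreover have "\<forall>\<^sub>F N in at M. c N > 0" using order_tendstoD(1)[OF c] by simp
    ultimately have "\<forall>\<^sub>F N in at M. sv N $ i - sv M $ i = inner (N - M) (inverse (c N) *\<^sub>R H N)"
    proof eventually_elim
      case (elim N)
      have "(sv N $ i - sv M $ i) * c N = inner (N - M) (H N)"
        using sv_difference[OF M, of N i] elim(1) by (simp add: c_def H_def P_def Q_def)
      then show ?case using elim(2) by (simp add: field_simps)
    qed
    then show ?thesis unfolding P_def[symmetric] by (rule caratheodory_derivative) (rule lim)
  qed
  then have "((\<lambda>N. \<chi> i. sv N $ i) has_derivative (\<lambda>X. \<chi> i. inner X (sing_proj M i))) (at M)"
    by (rule has_derivative_vec)
  then show ?thesis by simp
qed

text \<open>If \<open>sv\<close> has order \<open>k\<close>, so do the singular projections, which are its gradients; hence it has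
  order \<open>k + 1\<close>.\<close>

lemma smooth_on_sv: "smooth_on distinct_sv_matrices (sv :: ('f::star_algebra, 'm, 'n) matrix \<Rightarrow> _)"
proof -
  let ?S = "distinct_sv_matrices :: ('f, 'm, 'n) matrix set"
  have op: "open ?S" by (rule open_distinct_sv_matrices[OF mn])
  have "Ck_on k sv ?S" for k
  proof (induction k)
    case 0
    then show ?case using continuous_on_sv[OF mn] by simp
  next
    case (Suc k)
    have "Ck_on k (\<lambda>M. \<chi> i. inner X (sing_proj M i)) ?S" for X
      by (intro Ck_on_vec Ck_on_bilinear[OF bounded_bilinear_inner] Ck_on_sing_proj op Suc) simp_all
    then show ?case by (intro Ck_on_SucI[OF op has_derivative_sv])
  qed
  then show ?thesis by (simp add: smooth_on_def)
qed

lemma singular_value_submersion: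
  "submersion_with_section (distinct_sv_matrices :: ('f::star_algebra, 'm, 'n) matrix set)
     orbit sv weyl_chamber top_diag sing_proj"
proof -
  have "bounded_linear (top_diag :: _ \<Rightarrow> ('f, 'm, 'n) matrix)"
    using linear_top_diag by (simp add: linear_conv_bounded_linear)
  then show ?thesis
    by (intro submersion_with_section.intro) (simp_all add: open_distinct_sv_matrices[OF mn] open_weyl_chamber smooth_on_sv
        sv_weyl(1) sv_top_diag[OF mn] orbit_eq_iff[OF mn] has_derivative_sv proj_rules(4))
qed

theorem orbit_map_riemannian_submersion:
  "riemannian_submersion (distinct_sv_manifold :: (('f::star_algebra, 'm, 'n) matrix, _) rmanifold) orbit_manifold orbit"
  "euclidean_global_chart (orbit_manifold :: (('f, 'm, 'n) matrix set, _) rmanifold) weyl_chamber diag_orbit"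
proof -
  interpret submersion_with_section "distinct_sv_matrices :: ('f, 'm, 'n) matrix set"
    orbit sv weyl_chamber top_diag sing_proj by (rule singular_value_submersion)
  have N: "N = distinct_sv_manifold" by (simp add: N_def distinct_sv_manifold_def frobenius_eq_inner)
  then have Q: "Q = orbit_manifold" by (simp add: Q_def orbit_manifold_def)
  show "riemannian_submersion (distinct_sv_manifold :: (('f, 'm, 'n) matrix, _) rmanifold) orbit_manifold orbit"
    using riemannian_submersion_quotient by (simp add: N Q)
  have "orbit \<circ> top_diag = (diag_orbit :: _ \<Rightarrow> ('f, 'm, 'n) matrix set)" by (simp add: fun_eq_iff diag_orbit_def)
  then show "euclidean_global_chart (orbit_manifold :: (('f, 'm, 'n) matrix set, _) rmanifold) weyl_chamber diag_orbit"
    using euclidean_global_chart_quotient by (simp add: Q)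
qed

end

theorem proposition2p4:
  assumes "CARD('m::{finite,linorder}) < CARD('n::{finite,linorder})"
  shows
    "(riemannian_submersion
        (distinct_sv_manifold :: ((real, 'm, 'n) matrix, (real, 'm, 'n) matrix) rmanifold) orbit_manifold orbit \<and>
      euclidean_global_chart
        (orbit_manifold :: ((real, 'm, 'n) matrix set, (real, 'm) vec) rmanifold) weyl_chamber diag_orbit) \<and>
     (riemannian_submersion
        (distinct_sv_manifold :: ((complex, 'm, 'n) matrix, (complex, 'm, 'n) matrix) rmanifold) orbit_manifold orbit \<and>
      euclidean_global_chart
        (orbit_manifold :: ((complex, 'm, 'n) matrix set, (real, 'm) vec) rmanifold) weyl_chamber diag_orbit) \<and>
     (riemannian_submersion
        (distinct_sv_manifold :: ((quat, 'm, 'n) matrix, (quat, 'm, 'n) matrix) rmanifold) orbit_manifold orbit \<and>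
      euclidean_global_chart
        (orbit_manifold :: ((quat, 'm, 'n) matrix set, (real, 'm) vec) rmanifold) weyl_chamber diag_orbit)"
  by (intro conjI orbit_map_riemannian_submersion less_imp_le[OF assms])


end
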